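(* Let $\mathcal{A},\mathcal{B}$ be $C^*$-algebras, let $\Phi:\mathcal{A}\to\mathcal{B}$ be a tracial positive linear map, and let $\rho\in\mathcal{A}$ be a positive operator such that $\Phi(\rho)>0$. If $\Phi(\mathcal{A})$ is a commutative subspace of $\mathcal{B}$, then for all self-adjoint $A,B\in\mathcal{A}$ $$V'_{\rho,\Phi}(A)\,V'_{\rho,\Phi}(B)-\left|\mathrm{Re}\big(\mathrm{Cov}'_{\rho,\Phi}(A,B)\big)\right|^2\;\geq\;\frac14\left|\Phi(\rho[A,B])\right|^2 .$$ In particular, $$V'_{\rho,\Phi}(A)\,V'_{\rho,\Phi}(B)\;\geq\;\frac14\left|\Phi(\rho[A,B])\right|^2 .$$
   Context: A linear map $\Phi$ between $C^*$-algebras is positive if $\Phi(X)\ge 0$ whenever $X\ge 0$, and tracial if $\Phi(XY)=\Phi(YX)$ for all $X,Y$. $X>0$ means that $X$ is positive and invertible (so here $\mathcal{B}$ has a unit). $[A,B]=AB-BA$, $|X|=(X^*X)^{1/2}$, $\mathrm{Re}(X)=\frac12(X+X^* )$; $\le$ is the usual order on self-adjoint elements. "$\Phi(\mathcal{A})$ is commutative" means that any two elements of the range of $\Phi$ commute. For $A,B\in\mathcal{A}$, $$\mathrm{Cov}'_{\rho,\Phi}(A,B)=\Phi(\rho A^*B)-\Phi(\rho A^* )\Phi(\rho)^{-1}\Phi(\rho B),\qquad V'_{\rho,\Phi}(A)=\mathrm{Cov}'_{\rho,\Phi}(A,A).$$ *)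

theory Defs
  imports "HOL-Analysis.Analysis"
begin

class scaleC = scaleR +
  fixes scaleC :: "complex \<Rightarrow> 'a \<Rightarrow> 'a"  (infixr "*\<^sub>C" 75)
  assumes scaleR_scaleC: "r *\<^sub>R x = complex_of_real r *\<^sub>C x"

class star =
  fixes star :: "'a \<Rightarrow> 'a"  ("(_\<^sup>\<star>)" [1000] 999)

text \<open>
  The class does not assume a unit; \<open>real_normed_algebra\<close> supplies submultiplicativity
  of the norm and \<open>banach\<close> supplies completeness.
\<close>

class cstar_algebra = real_normed_algebra + banach + scaleC + star +
  assumes scaleC_add_right: "a *\<^sub>C (x + y) = a *\<^sub>C x + a *\<^sub>C y"
    and scaleC_add_left: "(a + b) *\<^sub>C x = a *\<^sub>C x + b *\<^sub>C x"
    and scaleC_scaleC: "a *\<^sub>C b *\<^sub>C x = (a * b) *\<^sub>C x"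
    and scaleC_one: "1 *\<^sub>C x = x"
    and mult_scaleC_left: "(a *\<^sub>C x) * y = a *\<^sub>C (x * y)"
    and mult_scaleC_right: "x * (a *\<^sub>C y) = a *\<^sub>C (x * y)"
    and norm_scaleC: "norm (a *\<^sub>C x) = cmod a * norm x"
    and star_add: "(x + y)\<^sup>\<star> = x\<^sup>\<star> + y\<^sup>\<star>"
    and star_scaleC: "(a *\<^sub>C x)\<^sup>\<star> = cnj a *\<^sub>C x\<^sup>\<star>"
    and star_mult: "(x * y)\<^sup>\<star> = y\<^sup>\<star> * x\<^sup>\<star>"
    and star_star: "(x\<^sup>\<star>)\<^sup>\<star> = x"
    and cstar_identity: "norm (x\<^sup>\<star> * x) = (norm x)\<^sup>2"

text \<open>The law \<open>0 \<noteq> 1\<close> is not assumed, so the zero algebra is included.\<close>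

class unital_cstar_algebra = cstar_algebra + monoid_mult

text \<open>The scalar field as an instance, so the classes are inhabited.\<close>

instantiation complex :: unital_cstar_algebra
begin
definition scaleC_complex :: "complex \<Rightarrow> complex \<Rightarrow> complex"
  where "scaleC_complex a x = a * x"
definition star_complex :: "complex \<Rightarrow> complex"
  where "star_complex x = cnj x"
instance
  by standard
    (auto simp: scaleC_complex_def star_complex_def scaleR_conv_of_real algebra_simps
      norm_mult power2_eq_square)
end

definition selfadjoint :: "'a::cstar_algebra \<Rightarrow> bool"
  where "selfadjoint x \<longleftrightarrow> x\<^sup>\<star> = x"

text \<open>
  Positivity is taken in the form \<open>x = y\<^sup>\<star> y\<close>, which needs no unit, unlike the
  condition on the spectrum.
\<close>

definition cstar_positive :: "'a::cstar_algebra \<Rightarrow> bool"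
  where "cstar_positive x \<longleftrightarrow> (\<exists>y. x = y\<^sup>\<star> * y)"

definition cstar_le :: "'a::cstar_algebra \<Rightarrow> 'a \<Rightarrow> bool"  (infix "\<le>\<^sub>*" 50)
  where "x \<le>\<^sub>* y \<longleftrightarrow> selfadjoint x \<and> selfadjoint y \<and> cstar_positive (y - x)"

definition cstar_invertible :: "'a::unital_cstar_algebra \<Rightarrow> bool"
  where "cstar_invertible x \<longleftrightarrow> (\<exists>y. x * y = 1 \<and> y * x = 1)"

definition cstar_inv :: "'a::unital_cstar_algebra \<Rightarrow> 'a"
  where "cstar_inv x = (THE y. x * y = 1 \<and> y * x = 1)"

definition strictly_positive :: "'a::unital_cstar_algebra \<Rightarrow> bool"
  where "strictly_positive x \<longleftrightarrow> cstar_positive x \<and> cstar_invertible x"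

definition cstar_sqrt :: "'a::cstar_algebra \<Rightarrow> 'a"
  where "cstar_sqrt x = (THE y. cstar_positive y \<and> y * y = x)"

definition cstar_abs :: "'a::cstar_algebra \<Rightarrow> 'a"
  where "cstar_abs x = cstar_sqrt (x\<^sup>\<star> * x)"

definition real_part :: "'a::cstar_algebra \<Rightarrow> 'a"
  where "real_part x = (1/2) *\<^sub>R (x + x\<^sup>\<star>)"

definition commutator :: "'a::cstar_algebra \<Rightarrow> 'a \<Rightarrow> 'a"
  where "commutator a b = a * b - b * a"

definition complex_linear :: "('a::cstar_algebra \<Rightarrow> 'b::cstar_algebra) \<Rightarrow> bool"
  where "complex_linear \<Phi> \<longleftrightarrow>
    (\<forall>x y. \<Phi> (x + y) = \<Phi> x + \<Phi> y) \<and> (\<forall>c x. \<Phi> (c *\<^sub>C x) = c *\<^sub>C \<Phi> x)"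

definition positive_map :: "('a::cstar_algebra \<Rightarrow> 'b::cstar_algebra) \<Rightarrow> bool"
  where "positive_map \<Phi> \<longleftrightarrow> (\<forall>x. cstar_positive x \<longrightarrow> cstar_positive (\<Phi> x))"

definition tracial :: "('a::cstar_algebra \<Rightarrow> 'b::cstar_algebra) \<Rightarrow> bool"
  where "tracial \<Phi> \<longleftrightarrow> (\<forall>x y. \<Phi> (x * y) = \<Phi> (y * x))"

definition commutative_set :: "'a::cstar_algebra set \<Rightarrow> bool"
  where "commutative_set S \<longleftrightarrow> (\<forall>x\<in>S. \<forall>y\<in>S. x * y = y * x)"

definition Cov' ::
    "'a::cstar_algebra \<Rightarrow> ('a \<Rightarrow> 'b::unital_cstar_algebra) \<Rightarrow> 'a \<Rightarrow> 'a \<Rightarrow> 'b"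
  where "Cov' \<rho> \<Phi> A B =
    \<Phi> (\<rho> * A\<^sup>\<star> * B) - \<Phi> (\<rho> * A\<^sup>\<star>) * cstar_inv (\<Phi> \<rho>) * \<Phi> (\<rho> * B)"

definition V' ::
    "'a::cstar_algebra \<Rightarrow> ('a \<Rightarrow> 'b::unital_cstar_algebra) \<Rightarrow> 'a \<Rightarrow> 'b"
  where "V' \<rho> \<Phi> A = Cov' \<rho> \<Phi> A A"

end

theory Submission
  imports Defs
begin

text \<open>
  Write \<open>\<rho> = w\<^sup>\<star> w\<close> and \<open>e = w\<^sup>\<star>\<close>. Since \<open>\<Phi>\<close> is tracial, \<open>\<Phi> (\<rho> X\<^sup>\<star> Y) = \<Phi> ((X e)\<^sup>\<star> (Y e))\<close>. So
  everything in the theorem is expressed by the positive sesquilinear form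
  \<open>\<langle>u, v\<rangle> = \<Phi> (u\<^sup>\<star> v)\<close>, whose values commute with each other, and the covariance of \<open>X\<close> and \<open>Y\<close> is its
  Schur complement \<open>\<langle>u, v\<rangle> - \<langle>u, e\<rangle> \<langle>e, e\<rangle>\<^sup>-\<^sup>1 \<langle>e, v\<rangle>\<close> at \<open>u = X e\<close> and \<open>v = Y e\<close>. For the covariance
  \<open>c\<close> of self-adjoint \<open>A\<close> and \<open>B\<close>, commutativity gives \<open>\<Phi> (\<rho> [A, B]) = c - c\<^sup>\<star>\<close>. As \<open>c\<close> is normal,
  \<open>|Re c|\<^sup>2 + |\<Phi> (\<rho> [A, B])|\<^sup>2 / 4 = c c\<^sup>\<star>\<close>, and the theorem says that the covariance form satisfies the
  Cauchy-Schwarz inequality (\<open>cov_cauchy_schwarz\<close>); its second part drops \<open>|Re c|\<^sup>2 \<ge> 0\<close>.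

  For scalars, the positivity of Schur complements and the Cauchy-Schwarz inequality both follow by
  minimising a quadratic polynomial. Here the coefficients and the minimiser are elements of a
  commutative subalgebra, while positivity of the form yields positivity of the polynomial
  only at scalar arguments. The bridge is \<open>positive_quadratic_substitution\<close>: if
  \<open>a + x b + x\<^sup>2 c \<ge> 0\<close> for all real \<open>x\<close>, then \<open>a + h b + h\<^sup>2 c \<ge> 0\<close> for every self-adjoint \<open>h\<close>
  that commutes with the coefficients. It takes the place of an evaluation at characters. The idea
  is that of the Bernstein operators: \<open>h\<close> is the mean of an algebra-valued
  probability distribution on real numbers, the endpoint of a random walk with many small steps,
  whose variance is as small as desired.

  This needs the basic facts on the order: sums of positive elements, products of commuting ones and
  limits are positive, and positive square roots are unique. They are obtained from the binomial
  series of the square root for squares of self-adjoint elements, and carry over to all elements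
  of the form \<open>x\<^sup>\<star> x\<close> because these are such squares (\<open>sa_square_star_mult_self\<close>).
\<close>

section \<open>Involution and norm\<close>

lemma star_zero [simp]: "(0::'a::cstar_algebra)\<^sup>\<star> = 0"
  using star_add[of "0::'a" 0] by simp

lemma star_minus [simp]: "(- x)\<^sup>\<star> = - (x::'a::cstar_algebra)\<^sup>\<star>"
  using star_add[of x "- x"] by (simp add: eq_neg_iff_add_eq_0 add.commute)

lemma star_diff: "(x - y)\<^sup>\<star> = (x::'a::cstar_algebra)\<^sup>\<star> - y\<^sup>\<star>"
  using star_add[of x "- y"] by simp

lemma star_scaleR: "(r *\<^sub>R x)\<^sup>\<star> = r *\<^sub>R (x::'a::cstar_algebra)\<^sup>\<star>"
  by (simp add: scaleR_scaleC star_scaleC)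

lemma star_one [simp]: "(1::'a::unital_cstar_algebra)\<^sup>\<star> = 1"
  using star_mult[of "(1::'a)\<^sup>\<star>" 1] by (simp add: star_star)

lemmas star_simps = star_add star_diff star_scaleR star_scaleC star_mult star_star

text \<open>
  Makes the vector space lemmas on negation, subtraction and cancellation available for complex
  scalars.
\<close>
interpretation complex_vs: vector_space "scaleC :: complex \<Rightarrow> 'a \<Rightarrow> 'a::cstar_algebra"
  by standard (simp_all add: scaleC_add_right scaleC_add_left scaleC_scaleC scaleC_one)

lemma norm_star [simp]: "norm ((x::'a::cstar_algebra)\<^sup>\<star>) = norm x"
proof -
  have le: "norm x \<le> norm (x\<^sup>\<star>)" for x :: 'a
  proof (cases "x = 0")
    case False
    have "norm x * norm x \<le> norm (x\<^sup>\<star>) * norm x"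
      using norm_mult_ineq[of "x\<^sup>\<star>" x] by (simp add: cstar_identity power2_eq_square)
    then show ?thesis
      using False by simp
  qed simp
  show ?thesis
    using le[of x] le[of "x\<^sup>\<star>"] by (simp add: star_star)
qed

lemma bounded_linear_star: "bounded_linear (star :: 'a::cstar_algebra \<Rightarrow> 'a)"
  by (rule bounded_linear_intro[where K = 1]) (simp_all add: star_simps)

lemma star_mult_self_eq_0_iff: "x\<^sup>\<star> * x = 0 \<longleftrightarrow> (x::'a::cstar_algebra) = 0"
  using cstar_identity[of x] by auto

lemma norm_square_selfadjoint: "selfadjoint x \<Longrightarrow> norm (x * x) = (norm x)\<^sup>2"
  using cstar_identity[of x] by (simp add: selfadjoint_def)

text \<open>
  The norm of the unit is an idempotent real number; it vanishes in the zero algebra.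
\<close>
lemma norm_one_le: "norm (1::'a::unital_cstar_algebra) \<le> 1"
proof -
  have "norm (1::'a) * norm (1::'a) = norm (1::'a) * 1"
    using cstar_identity[of "1::'a"] by (simp add: power2_eq_square)
  then show ?thesis
    by (auto simp: mult_cancel_left)
qed

lemma norm_power_le: "norm ((x::'a::unital_cstar_algebra) ^ n) \<le> norm x ^ n"
proof (induction n)
  case (Suc n)
  have "norm (x * x ^ n) \<le> norm x * norm (x ^ n)"
    by (rule norm_mult_ineq)
  also have "\<dots> \<le> norm x * norm x ^ n"
    by (rule mult_left_mono[OF Suc.IH]) simp
  finally show ?case by simp
qed (simp add: norm_one_le)

lemma selfadjoint_power: "selfadjoint x \<Longrightarrow> selfadjoint ((x::'a::unital_cstar_algebra) ^ n)"
  by (induction n) (simp_all add: selfadjoint_def star_mult power_commutes)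

text \<open>
  Squaring a self-adjoint element squares its norm, so the norm can be read off from the growth of
  the powers.
\<close>
lemma norm_power_two_power:
  assumes "selfadjoint (x::'a::unital_cstar_algebra)"
  shows "norm (x ^ (2 ^ k)) = norm x ^ (2 ^ k)"
proof (induction k)
  case (Suc k)
  have "norm (x ^ (2 ^ Suc k)) = norm (x ^ (2 ^ k) * x ^ (2 ^ k))"
    by (simp add: power_add[symmetric] mult_2)
  also have "\<dots> = (norm x ^ (2 ^ k))\<^sup>2"
    using norm_square_selfadjoint[OF selfadjoint_power[OF assms]] Suc.IH by simp
  finally show ?case
    by (simp add: power_mult[symmetric] mult.commute)
qed simp

lemma selfadjoint_intros:
  "selfadjoint (0::'a::cstar_algebra)"
  "selfadjoint (1::'b::unital_cstar_algebra)"
  "selfadjoint x \<Longrightarrow> selfadjoint y \<Longrightarrow> selfadjoint (x + y)"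
  "selfadjoint x \<Longrightarrow> selfadjoint y \<Longrightarrow> selfadjoint (x - y)"
  "selfadjoint x \<Longrightarrow> selfadjoint (- x)"
  "selfadjoint x \<Longrightarrow> selfadjoint (r *\<^sub>R x)"
  "selfadjoint x \<Longrightarrow> selfadjoint (x * x)"
  "selfadjoint (z\<^sup>\<star> * z)"
  for x y z :: "'a::cstar_algebra"
  by (simp_all add: selfadjoint_def star_simps)

lemma selfadjoint_mult_commuting:
  "selfadjoint x \<Longrightarrow> selfadjoint y \<Longrightarrow> x * y = y * x \<Longrightarrow> selfadjoint (x * y)"
  by (simp add: selfadjoint_def star_mult)

lemma star_inverse_selfadjoint:
  fixes c s :: "'a::unital_cstar_algebra"
  assumes "selfadjoint c" and "c * s = 1"
  shows "s\<^sup>\<star> = s"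
proof -
  have "s\<^sup>\<star> * c = (c * s)\<^sup>\<star>"
    using assms(1) by (simp add: star_mult selfadjoint_def)
  then have "s\<^sup>\<star> * c = 1"
    by (simp add: assms(2))
  moreover have "s\<^sup>\<star> = s\<^sup>\<star> * c * s"
    by (simp add: assms(2) mult.assoc)
  ultimately show ?thesis by simp
qed

section \<open>The square root of a perturbation of the unit\<close>

text \<open>
  The Taylor coefficients of \<open>\<surd>(1 - x)\<close> at \<open>0\<close>.
\<close>
definition sqrt_coeff :: "nat \<Rightarrow> real"
  where "sqrt_coeff n = (- 1) ^ n * ((1/2) gchoose n)"

definition sqrt_one_minus :: "'a::unital_cstar_algebra \<Rightarrow> 'a"
  where "sqrt_one_minus x = (\<Sum>n. sqrt_coeff n *\<^sub>R x ^ n)"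

lemma sqrt_coeff_0 [simp]: "sqrt_coeff 0 = 1"
  by (simp add: sqrt_coeff_def)

lemma sqrt_coeff_Suc_nonpos: "sqrt_coeff (Suc n) \<le> 0"
proof (induction n)
  case (Suc n)
  have "sqrt_coeff (Suc (Suc n)) = sqrt_coeff (Suc n) * ((real n + 1/2) / (real n + 2))"
    unfolding sqrt_coeff_def
    by (simp add: gbinomial_Suc_rec field_simps)
  then show ?case
    using Suc by (simp add: mult_nonpos_nonneg divide_nonpos_pos)
qed (simp add: sqrt_coeff_def)

text \<open>
  The partial sums of the coefficients are, up to sign, binomial coefficients of \<open>-1/2\<close>. As all
  coefficients but the first are non-positive, this bounds the sum of their absolute values, so that
  the series converges up to and including norm \<open>1\<close>.
\<close>
lemma sum_sqrt_coeff_nonneg: "0 \<le> (\<Sum>k\<le>n. sqrt_coeff k)"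
proof -
  have "0 \<le> (- 1) ^ n * ((- (1/2) :: real) gchoose n)" for n
  proof (induction n)
    case (Suc n)
    have "(- 1) ^ Suc n * ((- (1/2) :: real) gchoose Suc n)
        = (- 1) ^ n * (- (1/2) gchoose n) * ((real n + 1/2) / (real n + 1))"
      by (simp add: gbinomial_Suc_rec field_simps)
    then show ?case
      using Suc by (simp only: mult_nonneg_nonneg) simp
  qed simp
  moreover have "(\<Sum>k\<le>n. sqrt_coeff k) = (- 1) ^ n * ((- (1/2)) gchoose n)"
    using gbinomial_sum_lower_neg[of "1/2 :: real" n] by (simp add: sqrt_coeff_def mult.commute)
  ultimately show ?thesis by simp
qed

lemma sum_abs_sqrt_coeff_Suc_le: "(\<Sum>k<n. \<bar>sqrt_coeff (Suc k)\<bar>) \<le> 1"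
proof -
  have "(\<Sum>k<n. \<bar>sqrt_coeff (Suc k)\<bar>) = - (\<Sum>k<n. sqrt_coeff (Suc k))"
    by (simp add: abs_of_nonpos sqrt_coeff_Suc_nonpos sum_negf)
  also have "\<dots> = 1 - (\<Sum>k\<le>n. sqrt_coeff k)"
    by (simp add: sum.atMost_shift)
  finally show ?thesis
    using sum_sqrt_coeff_nonneg[of n] by simp
qed

lemma summable_abs_sqrt_coeff_Suc: "summable (\<lambda>n. \<bar>sqrt_coeff (Suc n)\<bar>)"
  by (rule summableI_nonneg_bounded[where x = 1]) (simp_all add: sum_abs_sqrt_coeff_Suc_le)

lemma norm_sqrt_term_le:
  assumes "norm (x::'a::unital_cstar_algebra) \<le> 1"
  shows "norm (sqrt_coeff n *\<^sub>R x ^ n) \<le> \<bar>sqrt_coeff n\<bar>"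
proof -
  have "norm (x ^ n) \<le> 1"
    using norm_power_le[of x n] power_le_one[of "norm x" n] assms by simp
  then show ?thesis
    by (simp add: mult_left_le)
qed

lemma summable_norm_sqrt_terms:
  assumes "norm (x::'a::unital_cstar_algebra) \<le> 1"
  shows "summable (\<lambda>n. norm (sqrt_coeff n *\<^sub>R x ^ n))"
proof -
  have "summable (\<lambda>n. \<bar>sqrt_coeff n\<bar>)"
    using summable_abs_sqrt_coeff_Suc by (rule summable_Suc_iff[THEN iffD1])
  then show ?thesis
    by (rule summable_norm_comparison_test[rotated]) (use norm_sqrt_term_le[OF assms] in blast)
qed

text \<open>
  The coefficients of the Cauchy product are, by the Vandermonde identity for \<open>1/2 + 1/2\<close>, those
  of \<open>(1 - x)\<^sup>1\<close>.
\<close>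
lemma sqrt_one_minus_square:
  assumes "norm (x::'a::unital_cstar_algebra) \<le> 1"
  shows "sqrt_one_minus x * sqrt_one_minus x = 1 - x"
proof -
  let ?a = "\<lambda>n. sqrt_coeff n *\<^sub>R x ^ n"
  have conv: "(\<Sum>i\<le>n. sqrt_coeff i * sqrt_coeff (n - i)) = (- 1) ^ n * ((1::real) gchoose n)" for n
  proof -
    have "(\<Sum>i\<le>n. sqrt_coeff i * sqrt_coeff (n - i))
        = (\<Sum>i\<le>n. (- 1) ^ n * ((1/2 gchoose i) * ((1/2::real) gchoose (n - i))))"
    proof (rule sum.cong)
      fix i assume "i \<in> {..n}"
      then have "(- 1 :: real) ^ n = (- 1) ^ i * (- 1) ^ (n - i)"
        by (simp add: power_add[symmetric])
      then show "sqrt_coeff i * sqrt_coeff (n - i)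
          = (- 1) ^ n * ((1/2 gchoose i) * ((1/2::real) gchoose (n - i)))"
        unfolding sqrt_coeff_def by simp
    qed simp
    also have "\<dots> = (- 1) ^ n * (\<Sum>i\<in>{0..n}. (1/2 gchoose i) * ((1/2::real) gchoose (n - i)))"
      by (simp add: sum_distrib_left atMost_atLeast0)
    finally show ?thesis
      by (subst (asm) gbinomial_Vandermonde) simp
  qed
  have "(\<Sum>i\<le>n. ?a i * ?a (n - i)) = ((- 1) ^ n * ((1::real) gchoose n)) *\<^sub>R x ^ n" for n
  proof -
    have "(\<Sum>i\<le>n. ?a i * ?a (n - i)) = (\<Sum>i\<le>n. (sqrt_coeff i * sqrt_coeff (n - i)) *\<^sub>R x ^ n)"
      by (rule sum.cong) (auto simp flip: power_add)
    then show ?thesis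
      by (simp only: scaleR_left.sum[symmetric] conv)
  qed
  moreover have "(\<lambda>n. ((- 1) ^ n * ((1::real) gchoose n)) *\<^sub>R x ^ n)
      sums (\<Sum>n\<in>{0, 1}. ((- 1) ^ n * ((1::real) gchoose n)) *\<^sub>R x ^ n)"
  proof (rule sums_finite)
    fix n :: nat assume "n \<notin> {0, 1}"
    then have "(1::real) gchoose n = 0"
      using binomial_gbinomial[of 1 n, where 'a = real] by (simp add: binomial_eq_0)
    then show "((- 1) ^ n * ((1::real) gchoose n)) *\<^sub>R x ^ n = 0" by simp
  qed simp
  ultimately have "(\<lambda>n. \<Sum>i\<le>n. ?a i * ?a (n - i))
      sums (\<Sum>n\<in>{0, 1}. ((- 1) ^ n * ((1::real) gchoose n)) *\<^sub>R x ^ n)"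
    by (simp only:)
  moreover have "(\<Sum>n\<in>{0, 1}. ((- 1) ^ n * ((1::real) gchoose n)) *\<^sub>R x ^ n) = 1 - x"
    by simp
  ultimately have "(\<lambda>n. \<Sum>i\<le>n. ?a i * ?a (n - i)) sums (1 - x)"
    by (simp only:)
  then show ?thesis
    unfolding sqrt_one_minus_def
    using Cauchy_product_sums[OF summable_norm_sqrt_terms[OF assms] summable_norm_sqrt_terms[OF assms]]
    by (rule sums_unique2[symmetric])
qed

text \<open>
  For \<open>z = x\<close>: the root commutes with everything that commutes with \<open>x\<close>.
\<close>
lemma sqrt_one_minus_intertwines:
  assumes "norm x \<le> 1" and "norm z \<le> 1" and "x * y = y * (z::'a::unital_cstar_algebra)"
  shows "sqrt_one_minus x * y = y * sqrt_one_minus z"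
proof -
  have "x ^ n * y = y * z ^ n" for n
  proof (induction n)
    case (Suc n)
    have "x ^ Suc n * y = x * (x ^ n * y)"
      by (simp add: mult.assoc)
    also have "\<dots> = y * z ^ Suc n"
      using Suc assms(3) by (simp add: mult.assoc[symmetric])
    finally show ?case .
  qed simp
  then have "(sqrt_coeff n *\<^sub>R x ^ n) * y = y * (sqrt_coeff n *\<^sub>R z ^ n)" for n
    by simp
  then show ?thesis
    unfolding sqrt_one_minus_def
      suminf_mult2[OF summable_norm_cancel[OF summable_norm_sqrt_terms[OF assms(1)]]]
      suminf_mult[OF summable_norm_cancel[OF summable_norm_sqrt_terms[OF assms(2)]], symmetric]
    by (simp only:)
qed

lemma selfadjoint_sqrt_one_minus:
  assumes "norm x \<le> 1" and "selfadjoint (x::'a::unital_cstar_algebra)"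
  shows "selfadjoint (sqrt_one_minus x)"
proof -
  have "(sqrt_coeff n *\<^sub>R x ^ n)\<^sup>\<star> = sqrt_coeff n *\<^sub>R x ^ n" for n
    using selfadjoint_power[OF assms(2), of n] by (simp add: star_scaleR selfadjoint_def)
  then show ?thesis
    unfolding selfadjoint_def sqrt_one_minus_def
      bounded_linear.suminf[OF bounded_linear_star
        summable_norm_cancel[OF summable_norm_sqrt_terms[OF assms(1)]]]
    by (simp only:)
qed

text \<open>
  This puts the root itself into the cone described below: an element within distance \<open>1\<close> of the
  unit is a square.
\<close>
lemma norm_one_minus_sqrt_le:
  assumes "norm (x::'a::unital_cstar_algebra) \<le> 1"
  shows "norm (1 - sqrt_one_minus x) \<le> 1"
proof -
  let ?a = "\<lambda>n. sqrt_coeff n *\<^sub>R x ^ n"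
  have sn: "summable (\<lambda>n. norm (?a (Suc n)))"
    using summable_norm_sqrt_terms[OF assms] by (subst summable_Suc_iff)
  have "1 - sqrt_one_minus x = - (\<Sum>n. ?a (Suc n))"
    unfolding sqrt_one_minus_def
    using suminf_split_head[OF summable_norm_cancel[OF summable_norm_sqrt_terms[OF assms]]]
    by simp
  also have "norm \<dots> \<le> (\<Sum>n. norm (?a (Suc n)))"
    unfolding norm_minus_cancel by (rule summable_norm[OF sn])
  also have "\<dots> \<le> (\<Sum>n. \<bar>sqrt_coeff (Suc n)\<bar>)"
    by (rule suminf_le[OF norm_sqrt_term_le[OF assms] sn summable_abs_sqrt_coeff_Suc])
  also have "\<dots> \<le> 1"
    by (rule suminf_le_const[OF summable_abs_sqrt_coeff_Suc sum_abs_sqrt_coeff_Suc_le])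
  finally show ?thesis .
qed

section \<open>The cone of squares of self-adjoint elements\<close>

text \<open>
  Squares of self-adjoint elements are positive, and the norm describes them completely: \<open>h\<close> is such
  a square iff it is self-adjoint and \<open>\<parallel>t - h\<parallel> \<le> t\<close> for some real \<open>t\<close>. The order-theoretic
  properties are proved for this notion first. That every \<open>x\<^sup>\<star> x\<close> is a square of this kind, so that it
  coincides with positivity, is the content of the next section.
\<close>
definition sa_square :: "'a::unital_cstar_algebra \<Rightarrow> bool"
  where "sa_square x \<longleftrightarrow> (\<exists>k. selfadjoint k \<and> x = k * k)"

lemma sa_square_selfadjoint: "sa_square x \<Longrightarrow> selfadjoint x"
  by (auto simp: sa_square_def selfadjoint_intros)

lemma sa_square_zero: "sa_square 0"
  unfolding sa_square_def by (rule exI[of _ 0]) (simp add: selfadjoint_intros)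

lemma sa_square_scaleR:
  assumes "sa_square x" and "0 \<le> r"
  shows "sa_square (r *\<^sub>R x)"
proof -
  obtain k where "selfadjoint k" "x = k * k"
    using assms(1) by (auto simp: sa_square_def)
  then show ?thesis
    unfolding sa_square_def using assms(2)
    by (intro exI[of _ "sqrt r *\<^sub>R k"]) (simp add: selfadjoint_intros)
qed

text \<open>
  The element \<open>k + \<i> u\<close> is \<open>\<surd>t\<close> times an isometry, and \<open>k\<close> is its real part.
\<close>
lemma norm_square_le_of_sum_squares:
  fixes k u :: "'a::unital_cstar_algebra"
  assumes k: "selfadjoint k" and u: "selfadjoint u" and comm: "k * u = u * k"
    and sum: "k * k + u * u = t *\<^sub>R 1" and t: "0 \<le> t"
  shows "(norm k)\<^sup>2 \<le> t"
proof -
  define w where "w = k + \<i> *\<^sub>C u"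
  have star_w: "w\<^sup>\<star> = k - \<i> *\<^sub>C u"
    using k u by (simp add: w_def star_simps selfadjoint_def)
  have "w\<^sup>\<star> * w = k * k + u * u"
    unfolding star_w by (simp add: w_def algebra_simps mult_scaleC_left mult_scaleC_right comm)
  then have "(norm w)\<^sup>2 = t * norm (1::'a)"
    using cstar_identity[of w] sum t by simp
  then have "(norm w)\<^sup>2 \<le> t"
    using mult_left_le[OF norm_one_le t] by simp
  moreover have "norm k \<le> norm w"
  proof -
    have "w + w\<^sup>\<star> = 2 *\<^sub>R k"
      unfolding star_w by (simp add: w_def scaleR_2)
    then show ?thesis
      using norm_triangle_ineq[of w "w\<^sup>\<star>"] by simp
  qed
  ultimately show ?thesis
    by (meson norm_ge_zero order_trans power_mono)
qed

text \<open>
  Scale to \<open>t = 1\<close> and complete the root \<open>k\<close> of \<open>h\<close> by \<open>u = \<surd>(1 - k\<^sup>2)\<close> to \<open>k\<^sup>2 + u\<^sup>2 = 1\<close>; then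
  \<open>\<parallel>1 - h\<parallel> = \<parallel>u\<parallel>\<^sup>2 \<le> 1\<close> by the preceding lemma.
\<close>
lemma norm_unit_minus_sa_square_le:
  assumes "sa_square (h::'a::unital_cstar_algebra)" and "norm h \<le> t"
  shows "norm (t *\<^sub>R 1 - h) \<le> t"
proof (cases "t = 0")
  case False
  then have t: "t > 0"
    using assms(2) norm_ge_zero[of h] by linarith
  obtain k where k: "selfadjoint k" "h = k * k"
    using assms(1) by (auto simp: sa_square_def)
  define x where "x = (1 / t) *\<^sub>R h"
  define u where "u = sqrt_one_minus x"
  have x: "norm x \<le> 1" "selfadjoint x"
    using t assms by (auto simp: x_def intro: selfadjoint_intros sa_square_selfadjoint)
  have u: "selfadjoint u" "u * u = 1 - x"
    unfolding u_def using x by (simp_all add: selfadjoint_sqrt_one_minus sqrt_one_minus_square)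
  have ku: "u * k = k * u"
    unfolding u_def by (rule sqrt_one_minus_intertwines) (use x in \<open>simp_all add: x_def k mult.assoc\<close>)
  have "(norm u)\<^sup>2 \<le> 1"
  proof (rule norm_square_le_of_sum_squares)
    show "selfadjoint ((1 / sqrt t) *\<^sub>R k)"
      using k by (simp add: selfadjoint_intros)
    show "u * u + ((1 / sqrt t) *\<^sub>R k) * ((1 / sqrt t) *\<^sub>R k) = 1 *\<^sub>R 1"
      using t u by (simp add: x_def k)
  qed (use u ku in simp_all)
  then have "norm (1 - x) \<le> 1"
    using norm_square_selfadjoint[OF u(1)] u(2) by simp
  moreover have "t *\<^sub>R 1 - h = t *\<^sub>R (1 - x)"
    using t by (simp add: x_def algebra_simps)
  ultimately show ?thesis
    using t by simp
qed (use assms in simp)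

lemma sa_squareI_norm_unit_minus:
  assumes "selfadjoint (h::'a::unital_cstar_algebra)" and "norm (t *\<^sub>R 1 - h) \<le> t"
  shows "sa_square h"
proof (cases "t = 0")
  case False
  then have t: "t > 0"
    using assms(2) norm_ge_zero[of "t *\<^sub>R 1 - h"] by linarith
  define x where "x = 1 - (1 / t) *\<^sub>R h"
  have tx: "x = (1 / t) *\<^sub>R (t *\<^sub>R 1 - h)"
    using t by (simp add: x_def scaleR_right_diff_distrib)
  have "norm x \<le> 1"
    unfolding tx using t assms(2) by simp
  moreover have "selfadjoint x"
    using assms(1) by (simp add: x_def selfadjoint_intros)
  ultimately have "sa_square (1 - x)"
    unfolding sa_square_def
    by (metis selfadjoint_sqrt_one_minus sqrt_one_minus_square)
  then have "sa_square (t *\<^sub>R (1 - x))"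
    using t by (simp add: sa_square_scaleR)
  moreover have "t *\<^sub>R (1 - x) = h"
    using t by (simp add: x_def)
  ultimately show ?thesis by simp
qed (use assms sa_square_zero in simp)

lemma sa_square_add:
  assumes "sa_square x" and "sa_square y"
  shows "sa_square (x + y)"
proof (rule sa_squareI_norm_unit_minus)
  have "norm ((norm x *\<^sub>R 1 - x) + (norm y *\<^sub>R 1 - y)) \<le> norm x + norm y"
    by (intro norm_triangle_mono norm_unit_minus_sa_square_le assms order_refl)
  then show "norm ((norm x + norm y) *\<^sub>R 1 - (x + y)) \<le> norm x + norm y"
    by (simp add: algebra_simps)
qed (use assms in \<open>simp add: selfadjoint_intros sa_square_selfadjoint\<close>)

lemma sa_square_closed:
  assumes lim: "X \<longlonglongrightarrow> (x::'a::unital_cstar_algebra)" and X: "\<And>n. sa_square (X n)"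
  shows "sa_square x"
proof -
  obtain t where t: "\<And>n. norm (X n) \<le> t"
    using convergent_imp_Bseq[OF convergentI[OF lim]] by (meson BseqE)
  show ?thesis
  proof (rule sa_squareI_norm_unit_minus)
    have "(\<lambda>n. norm (t *\<^sub>R 1 - X n)) \<longlonglongrightarrow> norm (t *\<^sub>R 1 - x)"
      by (intro tendsto_intros lim)
    then show "norm (t *\<^sub>R 1 - x) \<le> t"
      by (rule LIMSEQ_le_const2) (use norm_unit_minus_sa_square_le[OF X t] in blast)
    have "(\<lambda>n. (X n)\<^sup>\<star>) \<longlonglongrightarrow> x\<^sup>\<star>"
      by (rule bounded_linear.tendsto[OF bounded_linear_star lim])
    moreover have "(\<lambda>n. (X n)\<^sup>\<star>) = X"
      using sa_square_selfadjoint[OF X] by (simp add: selfadjoint_def)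
    ultimately have "X \<longlonglongrightarrow> x\<^sup>\<star>"
      by (simp only:)
    then show "selfadjoint x"
      unfolding selfadjoint_def using lim by (rule LIMSEQ_unique)
  qed
qed

text \<open>
  The binomial root lies in the bicommutant of \<open>h\<close>, so commuting elements have commuting roots. That
  it is a square itself enters the uniqueness of positive roots.
\<close>
lemma sa_square_root:
  assumes "sa_square (h::'a::unital_cstar_algebra)"
  obtains k where "sa_square k" and "k * k = h" and "\<And>y. h * y = y * h \<Longrightarrow> k * y = y * k"
proof (cases "h = 0")
  case True
  then show thesis
    by (intro that[of 0]) (simp_all add: sa_square_zero)
next
  case False
  then have t: "norm h > 0" by simp
  define x where "x = 1 - (1 / norm h) *\<^sub>R h"
  have tx: "x = (1 / norm h) *\<^sub>R (norm h *\<^sub>R 1 - h)"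
    using t by (simp add: x_def scaleR_right_diff_distrib)
  have x: "norm x \<le> 1" "selfadjoint x"
    unfolding tx using t norm_unit_minus_sa_square_le[OF assms order_refl] assms
    by (simp_all add: selfadjoint_intros sa_square_selfadjoint)
  define k where "k = sqrt (norm h) *\<^sub>R sqrt_one_minus x"
  show thesis
  proof
    have "sa_square (sqrt_one_minus x)"
      using norm_one_minus_sqrt_le[OF x(1)] selfadjoint_sqrt_one_minus[OF x]
      by (intro sa_squareI_norm_unit_minus[where t = 1]) simp_all
    then show "sa_square k"
      unfolding k_def by (rule sa_square_scaleR) simp
    have "k * k = norm h *\<^sub>R (1 - x)"
      using sqrt_one_minus_square[OF x(1)] by (simp add: k_def)
    then show "k * k = h"
      using False by (simp add: x_def)
    fix y assume "h * y = y * h"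
    then have "x * y = y * x"
      by (simp add: x_def algebra_simps)
    then show "k * y = y * k"
      using sqrt_one_minus_intertwines[OF x(1) x(1)] by (simp add: k_def)
  qed
qed

lemma sa_square_mult_commuting:
  assumes "sa_square x" and "sa_square y" and "x * y = y * x"
  shows "sa_square (x * y)"
proof -
  obtain k where k: "sa_square k" "k * k = x" "\<And>z. x * z = z * x \<Longrightarrow> k * z = z * k"
    using sa_square_root[OF assms(1)] by blast
  obtain l where l: "sa_square l" "l * l = y" "\<And>z. y * z = z * y \<Longrightarrow> l * z = z * l"
    using sa_square_root[OF assms(2)] by blast
  have "k * l = l * k"
    using k(3)[OF assms(3)] l(3)[of k] by simp
  then have "x * y = (k * l) * (k * l)" and "selfadjoint (k * l)"
    using k(1,2) l(1,2) sa_square_selfadjoint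
    by (metis mult.assoc, auto intro: selfadjoint_mult_commuting sa_square_selfadjoint)
  then show ?thesis
    by (auto simp: sa_square_def)
qed

text \<open>
  If \<open>k\<^sup>2 = x\<close> and \<open>l\<^sup>2 = -x\<close> with commuting \<open>k\<close> and \<open>l\<close>, then \<open>k\<^sup>2 + l\<^sup>2 = 0\<close>, which forces \<open>k = 0\<close>.
\<close>
lemma sa_square_antisym:
  assumes "sa_square x" and "sa_square (- x)"
  shows "x = 0"
proof -
  obtain k where k: "sa_square k" "k * k = x" "\<And>z. x * z = z * x \<Longrightarrow> k * z = z * k"
    using sa_square_root[OF assms(1)] by blast
  obtain l where l: "sa_square l" "l * l = - x" "\<And>z. - x * z = z * - x \<Longrightarrow> l * z = z * l"
    using sa_square_root[OF assms(2)] by blast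
  have "x * k = k * x"
    using k(2) by (metis mult.assoc)
  then have "k * l = l * k"
    using l(3)[of k] by simp
  then have "(norm k)\<^sup>2 \<le> 0"
    by (rule norm_square_le_of_sum_squares[rotated 2])
      (simp_all add: k(1,2) l(1,2) sa_square_selfadjoint)
  then show ?thesis
    using k(2) by auto
qed

text \<open>
  With \<open>d = p - q\<close>, the positive elements \<open>d\<^sup>2 p\<close> and \<open>d\<^sup>2 q\<close> add up to \<open>d (p\<^sup>2 - q\<^sup>2) = 0\<close>, so both
  vanish and \<open>d\<^sup>3 = 0\<close>.
\<close>
lemma sa_square_unique_root_commuting:
  assumes p: "sa_square p" and q: "sa_square q" and eq: "p * p = q * q" and comm: "p * q = q * p"
  shows "p = q"
proof -
  define d where "d = p - q"
  have d: "selfadjoint d"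
    using p q by (simp add: d_def selfadjoint_intros sa_square_selfadjoint)
  then have dd: "sa_square (d * d)"
    by (auto simp: sa_square_def)
  have zero: "d * (p + q) = 0"
    using eq comm by (simp add: d_def algebra_simps)
  have dp: "d * p = p * d" and dq: "d * q = q * d"
    using comm by (simp_all add: d_def algebra_simps)
  have "sa_square (d * d * p)" "sa_square (d * d * q)"
    using dd p q dp dq
    by (auto intro!: sa_square_mult_commuting) (metis mult.assoc)+
  moreover have "d * d * q = - (d * d * p)"
    using zero by (metis add.inverse_unique distrib_left mult.assoc mult_zero_right)
  ultimately have "d * d * p = 0" "d * d * q = 0"
    using sa_square_antisym[of "d * d * p"] by auto
  then have "d * d * d = 0"
    by (metis d_def diff_self right_diff_distrib)
  then have "(d * d) * (d * d) = 0"
    by (metis mult.assoc mult_zero_left)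
  then show ?thesis
    using norm_square_selfadjoint[OF selfadjoint_intros(7)[OF d]] norm_square_selfadjoint[OF d]
    by (simp add: d_def)
qed

section \<open>Every element of the form x* x is the square of a self-adjoint element\<close>

text \<open>
  This plays the role of the fact that \<open>y\<^sup>\<star> y\<close> and \<open>y y\<^sup>\<star>\<close> have the same non-zero spectrum. With
  \<open>u = 1 + y y\<^sup>\<star>\<close> and \<open>v = 1 + y\<^sup>\<star> y\<close> one has \<open>u\<^sup>n y = y v\<^sup>n\<close>, hence
  \<open>u\<^sup>n\<^sup>+\<^sup>1 - u\<^sup>n = y v\<^sup>n y\<^sup>\<star>\<close> is bounded in \<open>n\<close>. So \<open>\<parallel>u\<^sup>n\<parallel>\<close> grows at most linearly, whereas
  it equals \<open>\<parallel>u\<parallel>\<^sup>n\<close> for all powers of two \<open>n\<close>.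
\<close>
lemma norm_one_plus_flip_le:
  fixes y :: "'a::unital_cstar_algebra"
  assumes le: "norm (1 + y\<^sup>\<star> * y) \<le> 1"
  shows "norm (1 + y * y\<^sup>\<star>) \<le> 1"
proof (rule ccontr)
  define u where "u = 1 + y * y\<^sup>\<star>"
  define v where "v = 1 + y\<^sup>\<star> * y"
  define K where "K = norm y * norm y"
  define d where "d = norm u - 1"
  assume "\<not> norm (1 + y * y\<^sup>\<star>) \<le> 1"
  then have d: "d > 0" by (simp add: d_def u_def)
  have u: "selfadjoint u"
    by (simp add: u_def selfadjoint_def star_simps)
  have uy: "u ^ n * y = y * v ^ n" for n
  proof (induction n)
    case (Suc n)
    have "u ^ Suc n * y = u * (y * v ^ n)"
      using Suc by (simp add: mult.assoc)
    also have "\<dots> = y * v ^ Suc n"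
      by (simp add: u_def v_def algebra_simps)
    finally show ?case .
  qed simp
  have growth: "norm (u ^ n * (y * y\<^sup>\<star>)) \<le> K" for n
  proof -
    have "norm (v ^ n) \<le> 1"
      using norm_power_le[of v n] power_le_one[of "norm v" n] le by (simp add: v_def)
    have "norm (u ^ n * (y * y\<^sup>\<star>)) = norm (y * v ^ n * y\<^sup>\<star>)"
      using uy[of n] by (simp add: mult.assoc[symmetric])
    also have "\<dots> \<le> norm (y * v ^ n) * norm y"
      using norm_mult_ineq[of "y * v ^ n" "y\<^sup>\<star>"] by simp
    also have "\<dots> \<le> (norm y * norm (v ^ n)) * norm y"
      by (intro mult_right_mono norm_mult_ineq) simp
    also have "\<dots> \<le> (norm y * 1) * norm y"
      by (intro mult_right_mono mult_left_mono \<open>norm (v ^ n) \<le> 1\<close>) simp_all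
    finally show ?thesis by (simp add: K_def)
  qed
  have linear: "norm (u ^ n) \<le> 1 + real n * K" for n
  proof (induction n)
    case (Suc n)
    have "u ^ Suc n = u ^ n + u ^ n * (y * y\<^sup>\<star>)"
      by (simp only: power_Suc2) (simp add: u_def algebra_simps)
    then have "norm (u ^ Suc n) \<le> norm (u ^ n) + norm (u ^ n * (y * y\<^sup>\<star>))"
      by (simp only: norm_triangle_ineq)
    then show ?case
      using Suc growth[of n] by (simp add: algebra_simps)
  qed (simp add: norm_one_le)
  \<comment> \<open>With \<open>n = 2\<^sup>k\<close>, comparing \<open>(n d)\<^sup>2 \<le> \<parallel>u\<parallel>\<^sup>2\<^sup>n\<close> (Bernoulli) with the linear bound gives
    \<open>n d\<^sup>2 \<le> 1 + 2 K\<close>.\<close>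
  obtain k where k: "(1 + 2 * K) / d\<^sup>2 < 2 ^ k"
    using real_arch_pow[of 2 "(1 + 2 * K) / d\<^sup>2"] by auto
  define n where "n = (2::nat) ^ k"
  have n: "1 \<le> real n"
    by (simp add: n_def)
  have "real n * d \<le> (1 + d) ^ n"
    using Bernoulli_inequality[of d n] d by simp
  then have "(real n * d)\<^sup>2 \<le> ((1 + d) ^ n)\<^sup>2"
    using d by (intro power_mono) auto
  also have "\<dots> = norm u ^ (2 ^ Suc k)"
    by (simp add: d_def n_def power_mult[symmetric] mult.commute)
  also have "\<dots> \<le> 1 + real (2 * n) * K"
    using linear[of "2 ^ Suc k"] norm_power_two_power[OF u, of "Suc k"] by (simp add: n_def)
  also have "\<dots> \<le> real n * (1 + 2 * K)"
    using n by (simp add: algebra_simps)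
  finally have "real n * (real n * d\<^sup>2) \<le> real n * (1 + 2 * K)"
    by (simp add: power2_eq_square mult_ac)
  then have "real n * d\<^sup>2 \<le> 1 + 2 * K"
    using n by simp
  then show False
    using k d by (simp add: n_def field_simps)
qed

lemma sa_square_uminus_flip:
  fixes y :: "'a::unital_cstar_algebra"
  assumes "sa_square (- (y\<^sup>\<star> * y))"
  shows "sa_square (- (y * y\<^sup>\<star>))"
proof (cases "y = 0")
  case False
  define t where "t = norm y * norm y"
  define z where "z = (1 / norm y) *\<^sub>R y"
  have t: "t > 0"
    using False by (simp add: t_def)
  have z: "z\<^sup>\<star> * z = (1 / t) *\<^sub>R (y\<^sup>\<star> * y)" "z * z\<^sup>\<star> = (1 / t) *\<^sub>R (y * y\<^sup>\<star>)"
    by (simp_all add: z_def t_def star_scaleR)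
  have "norm (t *\<^sub>R 1 - - (y\<^sup>\<star> * y)) \<le> t"
    by (rule norm_unit_minus_sa_square_le[OF assms])
      (simp add: cstar_identity t_def power2_eq_square)
  moreover have "t *\<^sub>R 1 - - (y\<^sup>\<star> * y) = t *\<^sub>R (1 + z\<^sup>\<star> * z)"
    using t by (simp add: z algebra_simps)
  ultimately have "norm (1 + z\<^sup>\<star> * z) \<le> 1"
    using t by simp
  then have "norm (1 + z * z\<^sup>\<star>) \<le> 1"
    by (rule norm_one_plus_flip_le)
  then have "sa_square (- (z * z\<^sup>\<star>))"
    by (intro sa_squareI_norm_unit_minus[where t = 1]) (simp_all add: selfadjoint_def star_simps)
  then have "sa_square (t *\<^sub>R (- (z * z\<^sup>\<star>)))"
    using t by (simp only: sa_square_scaleR less_imp_le)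
  then show ?thesis
    using t by (simp add: z)
qed (simp add: sa_square_zero)

text \<open>
  If \<open>-y\<^sup>\<star> y\<close> is a square then so is \<open>-y y\<^sup>\<star>\<close>, but \<open>y\<^sup>\<star> y + y y\<^sup>\<star>\<close> is half the sum of
  the squares of the self-adjoint elements \<open>y + y\<^sup>\<star>\<close> and \<open>\<i> (y - y\<^sup>\<star>)\<close>. Hence \<open>y\<^sup>\<star> y\<close> is both
  positive and negative.
\<close>
lemma star_mult_self_nonpos_imp_zero:
  fixes y :: "'a::unital_cstar_algebra"
  assumes neg: "sa_square (- (y\<^sup>\<star> * y))"
  shows "y = 0"
proof -
  define h where "h = y + y\<^sup>\<star>"
  define k where "k = \<i> *\<^sub>C (y - y\<^sup>\<star>)"
  have hk: "selfadjoint h" "selfadjoint k"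
    by (simp_all add: h_def k_def selfadjoint_def star_simps complex_vs.scale_right_diff_distrib add.commute)
  have "k * k = - ((y - y\<^sup>\<star>) * (y - y\<^sup>\<star>))"
    unfolding k_def mult_scaleC_left mult_scaleC_right scaleC_scaleC by simp
  then have sum: "h * h + k * k = 2 *\<^sub>R (y\<^sup>\<star> * y + y * y\<^sup>\<star>)"
    unfolding scaleR_2 by (simp add: h_def algebra_simps)
  have "sa_square (h * h + k * k)"
    using hk by (intro sa_square_add) (auto simp: sa_square_def)
  then have "sa_square ((1/2) *\<^sub>R (2 *\<^sub>R (y\<^sup>\<star> * y + y * y\<^sup>\<star>)))"
    unfolding sum by (rule sa_square_scaleR) simp
  then have "sa_square (y\<^sup>\<star> * y + y * y\<^sup>\<star>)"
    by simp
  then have "sa_square ((y\<^sup>\<star> * y + y * y\<^sup>\<star>) + - (y * y\<^sup>\<star>))"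
    using sa_square_uminus_flip[OF neg] by (rule sa_square_add)
  then have "sa_square (y\<^sup>\<star> * y)"
    by simp
  then show ?thesis
    using sa_square_antisym[OF _ neg] star_mult_self_eq_0_iff by blast
qed

text \<open>
  Let \<open>m\<close> be the positive root of \<open>a\<^sup>2\<close> for \<open>a = x\<^sup>\<star> x\<close>, and \<open>q = m - a\<close>, twice the negative part of
  \<open>a\<close>. From \<open>m\<^sup>2 = a\<^sup>2\<close> follows \<open>a q = -m q\<close>, so that \<open>(x q)\<^sup>\<star> (x q) = q a q = -m q\<^sup>2\<close> is non-positive.
  Then \<open>x q = 0\<close>, which gives \<open>q\<^sup>2 = 0\<close> and \<open>a = m\<close>.
\<close>
lemma sa_square_star_mult_self: "sa_square (x\<^sup>\<star> * (x::'a::unital_cstar_algebra))"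
proof -
  define a where "a = x\<^sup>\<star> * x"
  have a: "selfadjoint a"
    by (simp add: a_def selfadjoint_intros)
  then have "sa_square (a * a)"
    by (auto simp: sa_square_def)
  then obtain m where m: "sa_square m" "m * m = a * a"
      and comm: "\<And>y. a * a * y = y * (a * a) \<Longrightarrow> m * y = y * m"
    by (rule sa_square_root) blast
  have ma: "m * a = a * m"
    by (rule comm) (simp add: mult.assoc)
  define q where "q = m - a"
  have q: "selfadjoint q"
    using a m by (simp add: q_def selfadjoint_intros sa_square_selfadjoint)
  have mq: "m * q = q * m" and aq: "a * q = - (m * q)"
    using m(2) ma by (simp_all add: q_def algebra_simps)
  have "sa_square (m * (q * q))"
  proof (rule sa_square_mult_commuting)
    show "sa_square (q * q)"
      using q by (auto simp: sa_square_def)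
    show "m * (q * q) = q * q * m"
      unfolding mult.assoc[symmetric] mq unfolding mult.assoc mq ..
  qed (rule m)
  moreover have "(x * q)\<^sup>\<star> * (x * q) = - (m * (q * q))"
  proof -
    have "(x * q)\<^sup>\<star> * (x * q) = q * (a * q)"
      using q by (simp add: star_mult selfadjoint_def a_def mult.assoc)
    also have "\<dots> = - (m * (q * q))"
      unfolding aq mult_minus_right mult.assoc[symmetric] mq
      unfolding mult.assoc mq ..
    finally show ?thesis .
  qed
  ultimately have "x * q = 0"
    by (intro star_mult_self_nonpos_imp_zero) simp
  then have "a * q = 0"
    by (simp add: a_def mult.assoc)
  moreover have "q * q = m * q - a * q"
    by (simp add: q_def algebra_simps)
  ultimately have "q * q = 0"
    using aq by simp
  then have "q = 0"
    using norm_square_selfadjoint[OF q] by simp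
  then show ?thesis
    using m(1) by (simp add: q_def a_def)
qed

lemma cstar_positive_iff_sa_square: "cstar_positive (x::'a::unital_cstar_algebra) \<longleftrightarrow> sa_square x"
  unfolding cstar_positive_def
  using sa_square_star_mult_self by (auto simp: sa_square_def selfadjoint_def) metis

lemmas positive_selfadjoint = sa_square_selfadjoint[folded cstar_positive_iff_sa_square]
lemmas positive_add = sa_square_add[folded cstar_positive_iff_sa_square]
lemmas positive_scaleR = sa_square_scaleR[folded cstar_positive_iff_sa_square]
lemmas positive_mult_commuting = sa_square_mult_commuting[folded cstar_positive_iff_sa_square]
lemmas positive_closed = sa_square_closed[folded cstar_positive_iff_sa_square]

lemma positive_mult_self: "selfadjoint x \<Longrightarrow> cstar_positive (x * x)"
  unfolding cstar_positive_def selfadjoint_def by metis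

lemma positive_one: "cstar_positive (1::'a::unital_cstar_algebra)"
  using positive_mult_self[of "1::'a"] by (simp add: selfadjoint_intros)

lemma positive_norm_minus:
  assumes "selfadjoint (x::'a::unital_cstar_algebra)" and "norm x \<le> t"
  shows "cstar_positive (t *\<^sub>R 1 - x)"
  unfolding cstar_positive_iff_sa_square
  by (rule sa_squareI_norm_unit_minus[where t = t]) (use assms in \<open>simp_all add: selfadjoint_intros\<close>)

text \<open>
  Any positive root of \<open>h\<close> commutes with \<open>h\<close>, hence with the binomial root, hence equals it. So the
  definite description in the definition of the root denotes.
\<close>
lemma cstar_sqrt_square:
  assumes "cstar_positive (h::'a::unital_cstar_algebra)"
  shows "cstar_sqrt h * cstar_sqrt h = h"
proof -
  have h: "sa_square h"
    using assms by (simp add: cstar_positive_iff_sa_square)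
  obtain k where k: "sa_square k" "k * k = h" and comm: "\<And>y. h * y = y * h \<Longrightarrow> k * y = y * k"
    using sa_square_root[OF h] by blast
  have "y = k" if "sa_square y" "y * y = h" for y
  proof -
    have yk: "k * y = y * k"
      by (rule comm) (simp only: that(2)[symmetric] mult.assoc)
    have "y * y = k * k"
      by (simp only: that(2) k(2))
    then show ?thesis
      by (rule sa_square_unique_root_commuting[OF that(1) k(1) _ yk[symmetric]])
  qed
  then have "cstar_sqrt h = k"
    unfolding cstar_sqrt_def cstar_positive_iff_sa_square
    by (intro the_equality conjI k) blast
  then show ?thesis
    using k(2) by (simp only:)
qed

lemma cstar_abs_square: "(cstar_abs (x::'a::unital_cstar_algebra))\<^sup>2 = x\<^sup>\<star> * x"
  unfolding power2_eq_square cstar_abs_def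
  by (rule cstar_sqrt_square) (auto simp: cstar_positive_def)

section \<open>Substituting algebra elements into non-negative quadratic polynomials\<close>

lemma scaleR_collect: "r *\<^sub>R v + (s *\<^sub>R v + w) = (r + s) *\<^sub>R v + (w::'a::real_vector)"
  by (simp add: scaleR_left_distrib)

text \<open>
  For \<open>-M \<le> h \<le> M\<close>, the weights \<open>(M \<mp> h) / (2 M)\<close> are positive and define an algebra-valued
  probability distribution on the two points \<open>x \<mp> s M\<close>, with mean \<open>x + s h\<close> and second moment
  \<open>x\<^sup>2 + 2 x s h + (s M)\<^sup>2\<close>. Averaging the values of the polynomial with these weights gives the
  expression in the conclusion, which is the polynomial at \<open>x + s h\<close> up to a multiple of \<open>s\<^sup>2\<close>.
\<close>
lemma positive_quadratic_substitution_step: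
  fixes a b c h :: "'a::unital_cstar_algebra" and s M :: real
  assumes pos: "\<And>x::real. cstar_positive (a + x *\<^sub>R b + x\<^sup>2 *\<^sub>R c)"
    and h: "selfadjoint h" "norm h \<le> M" "M > 0"
    and comm: "h * a = a * h" "h * b = b * h" "h * c = c * h"
  shows "cstar_positive ((a + s *\<^sub>R (h * b) + (s * M)\<^sup>2 *\<^sub>R c)
      + x *\<^sub>R (b + (2 * s) *\<^sub>R (h * c)) + x\<^sup>2 *\<^sub>R c)"
    (is "cstar_positive ?r")
proof -
  define q where "q y = a + y *\<^sub>R b + y\<^sup>2 *\<^sub>R c" for y :: real
  have hq: "h * q y = q y * h" for y
    by (simp add: q_def comm distrib_left distrib_right)
  have "cstar_positive ((M *\<^sub>R 1 - h) * q (x - s * M))"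
  proof (rule positive_mult_commuting)
    show "cstar_positive (M *\<^sub>R 1 - h)"
      by (rule positive_norm_minus[OF h(1,2)])
    show "cstar_positive (q (x - s * M))"
      unfolding q_def by (rule pos)
  qed (simp add: algebra_simps hq)
  moreover have "cstar_positive ((M *\<^sub>R 1 - - h) * q (x + s * M))"
  proof (rule positive_mult_commuting)
    show "cstar_positive (M *\<^sub>R 1 - - h)"
      by (rule positive_norm_minus) (use h in \<open>simp_all add: selfadjoint_intros\<close>)
    show "cstar_positive (q (x + s * M))"
      unfolding q_def by (rule pos)
  qed (simp add: algebra_simps hq)
  ultimately have "cstar_positive ((M *\<^sub>R 1 - h) * q (x - s * M) + (M *\<^sub>R 1 - - h) * q (x + s * M))"
    by (rule positive_add)
  also have "(M *\<^sub>R 1 - h) * q (x - s * M) + (M *\<^sub>R 1 - - h) * q (x + s * M) = (2 * M) *\<^sub>R ?r"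
    by (simp add: q_def algebra_simps scaleR_left_distrib scaleR_left_diff_distrib power2_eq_square)
      (simp add: scaleR_collect mult_ac flip: scaleR_left_distrib)
  finally have "cstar_positive ((1 / (2 * M)) *\<^sub>R ((2 * M) *\<^sub>R ?r))"
    by (rule positive_scaleR) (use h in simp)
  then show ?thesis
    using h by simp
qed

text \<open>
  Positivity at real arguments extends to commuting self-adjoint arguments. The result of a
  step is again a quadratic polynomial that is positive at all real arguments, so the step can be
  iterated. After \<open>n\<close> steps with \<open>s = 1/n\<close>, starting at \<open>0\<close>, the mean is \<open>h\<close> and the
  excess of the second moment over \<open>h\<^sup>2\<close> is \<open>(M\<^sup>2 - h\<^sup>2) / n\<close>, which tends to \<open>0\<close>.
\<close>
lemma positive_quadratic_substitution:
  fixes a b c h :: "'a::unital_cstar_algebra"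
  assumes pos: "\<And>x::real. cstar_positive (a + x *\<^sub>R b + x\<^sup>2 *\<^sub>R c)"
    and h: "selfadjoint h"
    and comm: "h * a = a * h" "h * b = b * h" "h * c = c * h"
  shows "cstar_positive (a + h * b + h * h * c)"
proof -
  \<comment> \<open>The summand \<open>1\<close> keeps \<open>M\<close> positive for \<open>h = 0\<close>.\<close>
  define M where "M = norm h + 1"
  have M: "norm h \<le> M" "M > 0"
    by (simp_all add: M_def add_nonneg_pos)
  \<comment> \<open>The coefficients after \<open>k\<close> steps of size \<open>s\<close>; the leading coefficient stays \<open>c\<close>.\<close>
  define A where "A s k = a + (real k * s) *\<^sub>R (h * b)
      + (real k * (real k - 1) * s\<^sup>2) *\<^sub>R (h * h * c) + (real k * (s * M)\<^sup>2) *\<^sub>R c" for s k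
  define B where "B s k = b + (2 * real k * s) *\<^sub>R (h * c)" for s k
  have step: "cstar_positive (A s k + x *\<^sub>R B s k + x\<^sup>2 *\<^sub>R c)" for s x k
  proof (induction k arbitrary: x)
    case 0
    show ?case
      using pos by (simp add: A_def B_def)
  next
    case (Suc k)
    have A': "A s k + s *\<^sub>R (h * B s k) + (s * M)\<^sup>2 *\<^sub>R c = A s (Suc k)"
      by (simp add: A_def B_def algebra_simps scaleR_left_distrib scaleR_left_diff_distrib power2_eq_square)
        (simp add: scaleR_collect mult_ac flip: scaleR_left_distrib)
    have B': "B s k + (2 * s) *\<^sub>R (h * c) = B s (Suc k)"
      by (simp add: B_def algebra_simps scaleR_left_distrib)
    have "h * (h * b) = h * b * h" "h * (h * c) = h * c * h" "h * (h * h * c) = h * h * c * h"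
      by (simp_all add: mult.assoc comm[symmetric])
    then have "h * A s k = A s k * h" "h * B s k = B s k * h"
      by (simp_all add: A_def B_def distrib_left distrib_right comm)
    from positive_quadratic_substitution_step[OF Suc h M this comm(3), of s x]
    show ?case
      unfolding A' B' .
  qed
  have "cstar_positive (A (1 / real (Suc n)) (Suc n))" for n
    using step[of "1 / real (Suc n)" "Suc n" 0] by simp
  moreover have "A (1 / real (Suc n)) (Suc n)
      = (a + h * b + h * h * c) + (1 / real (Suc n)) *\<^sub>R (M\<^sup>2 *\<^sub>R c - h * h * c)" for n
  proof -
    have c1: "real (Suc n) * (1 / real (Suc n)) = 1"
      and c2: "real (Suc n) * (real (Suc n) - 1) * (1 / real (Suc n))\<^sup>2 = 1 - 1 / real (Suc n)"
      and c3: "real (Suc n) * (1 / real (Suc n) * M)\<^sup>2 = 1 / real (Suc n) * M\<^sup>2"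
      by (simp_all add: field_simps power2_eq_square del: of_nat_Suc)
    show ?thesis
      unfolding A_def c1 c2 c3 by (simp add: algebra_simps scaleR_left_diff_distrib del: of_nat_Suc)
  qed
  ultimately have pos': "cstar_positive ((a + h * b + h * h * c)
      + (1 / real (Suc n)) *\<^sub>R (M\<^sup>2 *\<^sub>R c - h * h * c))" for n
    by simp
  have "(\<lambda>n. (a + h * b + h * h * c) + (1 / real (Suc n)) *\<^sub>R (M\<^sup>2 *\<^sub>R c - h * h * c))
      \<longlonglongrightarrow> (a + h * b + h * h * c) + 0 *\<^sub>R (M\<^sup>2 *\<^sub>R c - h * h * c)"
    using LIMSEQ_inverse_real_of_nat
    by (intro tendsto_intros) (simp add: inverse_eq_divide)
  then have "(\<lambda>n. (a + h * b + h * h * c) + (1 / real (Suc n)) *\<^sub>R (M\<^sup>2 *\<^sub>R c - h * h * c))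
      \<longlonglongrightarrow> a + h * b + h * h * c"
    by simp
  then show ?thesis
    by (rule positive_closed) (rule pos')
qed

lemma positive_of_positive_perturbation:
  fixes x y :: "'a::unital_cstar_algebra"
  assumes "\<And>\<epsilon>. \<epsilon> > 0 \<Longrightarrow> cstar_positive (x + \<epsilon> *\<^sub>R y)"
  shows "cstar_positive x"
proof (rule positive_closed)
  have "(\<lambda>n. x + inverse (real (Suc n)) *\<^sub>R y) \<longlonglongrightarrow> x + 0 *\<^sub>R y"
    by (intro tendsto_intros LIMSEQ_inverse_real_of_nat)
  then show "(\<lambda>n. x + inverse (real (Suc n)) *\<^sub>R y) \<longlonglongrightarrow> x"
    by simp
qed (rule assms, simp)

section \<open>Commutative subalgebras and the Cauchy-Schwarz inequality\<close>

text \<open>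
  Closure under inverses makes the Schur complements of elements of \<open>W\<close> lie in \<open>W\<close>.
\<close>
locale commutative_star_subalgebra =
  fixes W :: "'a::unital_cstar_algebra set"
  assumes commute: "x \<in> W \<Longrightarrow> y \<in> W \<Longrightarrow> x * y = y * x"
    and one_closed: "1 \<in> W"
    and add_closed: "x \<in> W \<Longrightarrow> y \<in> W \<Longrightarrow> x + y \<in> W"
    and mult_closed: "x \<in> W \<Longrightarrow> y \<in> W \<Longrightarrow> x * y \<in> W"
    and scaleC_closed: "x \<in> W \<Longrightarrow> z *\<^sub>C x \<in> W"
    and star_closed: "x \<in> W \<Longrightarrow> x\<^sup>\<star> \<in> W"
    and inverse_closed: "x \<in> W \<Longrightarrow> x * y = 1 \<Longrightarrow> y * x = 1 \<Longrightarrow> y \<in> W"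
begin

lemma left_commute: "x \<in> W \<Longrightarrow> y \<in> W \<Longrightarrow> x * (y * z) = y * (x * z)"
  using commute[of x y] by (simp only: mult.assoc[symmetric])

lemma scaleR_closed: "x \<in> W \<Longrightarrow> r *\<^sub>R x \<in> W"
  by (simp add: scaleR_scaleC scaleC_closed)

lemma uminus_closed: "x \<in> W \<Longrightarrow> - x \<in> W"
  using scaleR_closed[of x "- 1"] by simp

lemma diff_closed: "x \<in> W \<Longrightarrow> y \<in> W \<Longrightarrow> x - y \<in> W"
  using add_closed[of x "- y"] by (simp add: uminus_closed)

lemmas closed = one_closed add_closed mult_closed scaleC_closed star_closed scaleR_closed
  uminus_closed diff_closed

text \<open>
  With \<open>z = x + \<i> y\<close> the expression is quadratic in each of the real variables \<open>x\<close> and \<open>y\<close>. The real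
  and imaginary parts of \<open>g\<close> are substituted for them one after the other.
\<close>
lemma positive_complex_quadratic_substitution:
  assumes W: "a \<in> W" "b \<in> W" "c \<in> W" "g \<in> W"
    and pos: "\<And>z. cstar_positive (a + z *\<^sub>C b + cnj z *\<^sub>C b\<^sup>\<star> + (cmod z)\<^sup>2 *\<^sub>R c)"
  shows "cstar_positive (a + g * b + g\<^sup>\<star> * b\<^sup>\<star> + g\<^sup>\<star> * g * c)"
proof -
  define h where "h = (1/2) *\<^sub>R (g + g\<^sup>\<star>)"
  define k where "k = (- \<i> / 2) *\<^sub>C (g - g\<^sup>\<star>)"
  define e where "e = \<i> *\<^sub>C (b - b\<^sup>\<star>)"
  have hk: "selfadjoint h" "selfadjoint k"
    by (simp_all add: h_def k_def selfadjoint_def star_simps complex_vs.scale_right_diff_distrib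
        complex_vs.scale_minus_left add.commute)
  have hkW: "h \<in> W" "k \<in> W" and eW: "e \<in> W"
    by (simp_all add: h_def k_def e_def W closed)
  have \<i>k: "\<i> *\<^sub>C k = (1/2) *\<^sub>R (g - g\<^sup>\<star>)"
    by (simp add: k_def scaleC_scaleC scaleR_scaleC)
  have half: "(1/2) *\<^sub>R (x + y) + (1/2) *\<^sub>R (x - y) = x" for x y :: 'a
    by (simp add: scaleR_add_right[symmetric] scaleR_2[symmetric])
  have half': "(1/2) *\<^sub>R (x + y) - (1/2) *\<^sub>R (x - y) = y" for x y :: 'a
    by (simp add: scaleR_diff_right[symmetric] scaleR_2[symmetric])
  have g: "g = h + \<i> *\<^sub>C k" and g': "g\<^sup>\<star> = h - \<i> *\<^sub>C k"
    unfolding \<i>k h_def by (simp_all only: half half')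
  have first: "cstar_positive ((a + y *\<^sub>R e + y\<^sup>2 *\<^sub>R c) + h * (b + b\<^sup>\<star>) + h * h * c)" for y :: real
  proof (rule positive_quadratic_substitution[OF _ hk(1)])
    fix x :: real
    have "(a + y *\<^sub>R e + y\<^sup>2 *\<^sub>R c) + x *\<^sub>R (b + b\<^sup>\<star>) + x\<^sup>2 *\<^sub>R c
        = a + Complex x y *\<^sub>C b + cnj (Complex x y) *\<^sub>C b\<^sup>\<star> + (cmod (Complex x y))\<^sup>2 *\<^sub>R c"
      unfolding Complex_eq e_def scaleR_scaleC
      by (simp add: scaleC_add_left scaleC_add_right scaleC_scaleC cmod_power2
          complex_vs.scale_right_diff_distrib complex_vs.scale_left_diff_distrib
          complex_vs.scale_minus_left mult.commute algebra_simps)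
    then show "cstar_positive ((a + y *\<^sub>R e + y\<^sup>2 *\<^sub>R c) + x *\<^sub>R (b + b\<^sup>\<star>) + x\<^sup>2 *\<^sub>R c)"
      using pos[of "Complex x y"] by (simp only:)
  qed (rule commute, simp_all add: W hkW eW closed)+
  have "cstar_positive ((a + h * (b + b\<^sup>\<star>) + h * h * c) + k * e + k * k * c)"
  proof (rule positive_quadratic_substitution[OF _ hk(2)])
    fix y :: real
    show "cstar_positive ((a + h * (b + b\<^sup>\<star>) + h * h * c) + y *\<^sub>R e + y\<^sup>2 *\<^sub>R c)"
      using first[of y] by (simp add: add_ac)
  qed (rule commute, simp_all add: W hkW eW closed)+
  also have "(a + h * (b + b\<^sup>\<star>) + h * h * c) + k * e + k * k * c
      = a + g * b + g\<^sup>\<star> * b\<^sup>\<star> + g\<^sup>\<star> * g * c"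
  proof -
    have "g\<^sup>\<star> * g = h * h + k * k"
      unfolding g' unfolding g
      by (simp add: algebra_simps mult_scaleC_left mult_scaleC_right scaleC_scaleC commute[OF hkW])
    moreover have "g * b + g\<^sup>\<star> * b\<^sup>\<star> = h * (b + b\<^sup>\<star>) + k * e"
      unfolding g' unfolding g e_def
      by (simp add: algebra_simps mult_scaleC_left mult_scaleC_right)
    ultimately show ?thesis
      by (simp add: algebra_simps)
  qed
  finally show ?thesis .
qed

text \<open>
  The quadratic polynomial is evaluated at its minimiser \<open>g = -c\<^sup>-\<^sup>1 b\<^sup>\<star>\<close>; here \<open>s\<close> is the inverse of \<open>c\<close>.
\<close>
lemma schur_complement_positive:
  assumes W: "a \<in> W" "b \<in> W" "c \<in> W" and c: "selfadjoint c" and s: "c * s = 1" "s * c = 1"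
    and pos: "\<And>z. cstar_positive (a + z *\<^sub>C b + cnj z *\<^sub>C b\<^sup>\<star> + (cmod z)\<^sup>2 *\<^sub>R c)"
  shows "cstar_positive (a - b * s * b\<^sup>\<star>)"
proof -
  have sW: "s \<in> W"
    by (rule inverse_closed[OF W(3) s])
  have s': "s\<^sup>\<star> = s"
    by (rule star_inverse_selfadjoint[OF c s(1)])
  define g where "g = - (s * b\<^sup>\<star>)"
  have g': "g\<^sup>\<star> = - (b * s)"
    by (simp add: g_def star_simps s')
  have gW: "g \<in> W"
    by (simp add: g_def W sW closed)
  have gb: "g * b = - (b * s * b\<^sup>\<star>)"
    using commute[of "s * b\<^sup>\<star>" b] by (simp add: g_def W sW closed mult.assoc)
  have "g\<^sup>\<star> * g * c = b * s * (s * b\<^sup>\<star> * c)"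
    unfolding g' by (simp add: g_def mult.assoc)
  also have "s * b\<^sup>\<star> * c = s * (c * b\<^sup>\<star>)"
    using commute[of c "b\<^sup>\<star>"] by (simp add: W closed mult.assoc)
  also have "s * (c * b\<^sup>\<star>) = b\<^sup>\<star>"
    by (simp add: mult.assoc[symmetric] s)
  finally have "a + g * b + g\<^sup>\<star> * b\<^sup>\<star> + g\<^sup>\<star> * g * c = a - b * s * b\<^sup>\<star>"
    by (simp add: gb g')
  then show ?thesis
    using positive_complex_quadratic_substitution[OF W gW pos] by (simp only:)
qed

end

text \<open>
  The Neumann series.
\<close>
lemma inverse_one_minus:
  assumes "norm (y::'a::unital_cstar_algebra) < 1"
  obtains s where "(1 - y) * s = 1" and "s * (1 - y) = 1"
proof -
  have "norm (y ^ n) \<le> norm y ^ n" for n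
    by (rule norm_power_le)
  then have "summable (\<lambda>n. norm (y ^ n))"
    by (intro summable_norm_comparison_test[OF _ summable_geometric]) (use assms in auto)
  then have sm: "summable (\<lambda>n. y ^ n)"
    by (rule summable_norm_cancel)
  define s where "s = (\<Sum>n. y ^ n)"
  have head: "(\<Sum>n. y ^ Suc n) = s - 1"
    using suminf_split_head[OF sm] by (simp add: s_def del: power_Suc)
  have "y * s = s - 1"
    unfolding head[symmetric] using suminf_mult[OF sm, of y] by (simp add: s_def)
  moreover have "s * y = s - 1"
    unfolding head[symmetric] using suminf_mult2[OF sm, of y]
    by (simp add: s_def power_commutes)
  ultimately show thesis
    by (intro that[of s]) (simp_all add: algebra_simps)
qed

lemma inverse_positive_plus:
  assumes "cstar_positive (c::'a::unital_cstar_algebra)" and "\<epsilon> > 0"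
  obtains s where "(c + \<epsilon> *\<^sub>R 1) * s = 1" and "s * (c + \<epsilon> *\<^sub>R 1) = 1"
proof -
  define t where "t = norm c + \<epsilon>"
  have t: "t > 0"
    using assms(2) by (simp add: t_def add_nonneg_pos)
  define y where "y = (1 / t) *\<^sub>R (norm c *\<^sub>R 1 - c)"
  have "norm (norm c *\<^sub>R 1 - c) \<le> norm c"
    using assms(1) by (intro norm_unit_minus_sa_square_le) (simp_all add: cstar_positive_iff_sa_square)
  then have "norm y < 1"
    using assms(2) t by (simp add: y_def t_def)
  then obtain r where r: "(1 - y) * r = 1" "r * (1 - y) = 1"
    by (rule inverse_one_minus)
  have "t *\<^sub>R y = norm c *\<^sub>R 1 - c"
    using t by (simp add: y_def)
  then have "c + \<epsilon> *\<^sub>R 1 = t *\<^sub>R (1 - y)"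
    by (simp add: t_def algebra_simps)
  then show thesis
    using r t by (intro that[of "(1 / t) *\<^sub>R r"]) simp_all
qed

context commutative_star_subalgebra
begin

text \<open>
  Since \<open>c\<close> may fail to be invertible, the Schur complement is formed with \<open>c + \<epsilon>\<close> in place of \<open>c\<close>.
  Multiplying it by \<open>c + \<epsilon>\<close> clears the inverse, and \<open>\<epsilon>\<close> can tend to \<open>0\<close>.
\<close>
lemma cauchy_schwarz:
  assumes W: "a \<in> W" "b \<in> W" "c \<in> W"
    and pos: "\<And>z. cstar_positive (a + z *\<^sub>C b + cnj z *\<^sub>C b\<^sup>\<star> + (cmod z)\<^sup>2 *\<^sub>R c)"
    and c: "cstar_positive c"
  shows "cstar_positive (a * c - b * b\<^sup>\<star>)"
proof (rule positive_of_positive_perturbation)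
  fix \<epsilon> :: real assume \<epsilon>: "\<epsilon> > 0"
  define v where "v = c + \<epsilon> *\<^sub>R 1"
  obtain s where s: "v * s = 1" "s * v = 1"
    unfolding v_def using inverse_positive_plus[OF c \<epsilon>] .
  have v: "cstar_positive v" "v \<in> W"
    unfolding v_def using c \<epsilon> by (simp_all add: positive_add positive_scaleR positive_one W closed)
  have sW: "s \<in> W"
    by (rule inverse_closed[OF v(2) s])
  have "cstar_positive (a - b * s * b\<^sup>\<star>)"
  proof (rule schur_complement_positive[OF W(1,2) v(2) _ s])
    fix z
    have "cstar_positive ((a + z *\<^sub>C b + cnj z *\<^sub>C b\<^sup>\<star> + (cmod z)\<^sup>2 *\<^sub>R c) + ((cmod z)\<^sup>2 * \<epsilon>) *\<^sub>R 1)"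
      using \<epsilon> by (intro positive_add pos positive_scaleR positive_one) simp
    then show "cstar_positive (a + z *\<^sub>C b + cnj z *\<^sub>C b\<^sup>\<star> + (cmod z)\<^sup>2 *\<^sub>R v)"
      by (simp add: v_def scaleR_add_right add.assoc)
  qed (rule positive_selfadjoint[OF v(1)])
  then have "cstar_positive ((a - b * s * b\<^sup>\<star>) * v)"
    by (rule positive_mult_commuting[OF _ v(1)]) (rule commute, simp_all add: W sW v closed)
  also have "(a - b * s * b\<^sup>\<star>) * v = (a * c - b * b\<^sup>\<star>) + \<epsilon> *\<^sub>R a"
  proof -
    have "b * s * b\<^sup>\<star> * v = b * (s * (v * b\<^sup>\<star>))"
      using commute[of v "b\<^sup>\<star>"] by (simp add: W v closed mult.assoc)
    also have "\<dots> = b * b\<^sup>\<star>"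
      using s(2) by (simp add: mult.assoc[symmetric, of s])
    finally show ?thesis
      by (simp add: v_def algebra_simps)
  qed
  finally show "cstar_positive (a * c - b * b\<^sup>\<star> + \<epsilon> *\<^sub>R a)" .
qed

end

definition commutant :: "'a::times set \<Rightarrow> 'a set"
  where "commutant S = {x. \<forall>y\<in>S. x * y = y * x}"

text \<open>
  A commutative set lies in its commutant, so its bicommutant lies in its commutant too, and
  therefore any two elements of the bicommutant commute.
\<close>
lemma bicommutant_commutative_star_subalgebra:
  fixes S :: "'a::unital_cstar_algebra set"
  assumes comm: "commutative_set S" and star: "\<And>x. x \<in> S \<Longrightarrow> x\<^sup>\<star> \<in> S"
  shows "commutative_star_subalgebra (commutant (commutant S))"
proof
  show "1 \<in> commutant (commutant S)"
    by (simp add: commutant_def)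
next
  fix x assume x: "x \<in> commutant (commutant S)"
  show "x\<^sup>\<star> \<in> commutant (commutant S)"
    unfolding commutant_def
  proof (intro CollectI ballI)
    fix y assume "y \<in> {x. \<forall>y\<in>S. x * y = y * x}"
    then have "\<forall>w\<in>S. y * w\<^sup>\<star> = w\<^sup>\<star> * y"
      using star by blast
    then have "\<forall>w\<in>S. y\<^sup>\<star> * w = w * y\<^sup>\<star>"
      by (metis star_mult star_star)
    then have "x * y\<^sup>\<star> = y\<^sup>\<star> * x"
      using x by (simp add: commutant_def)
    then show "x\<^sup>\<star> * y = y * x\<^sup>\<star>"
      by (metis star_mult star_star)
  qed
next
  fix x y assume "x \<in> commutant (commutant S)" "y \<in> commutant (commutant S)"
  moreover have "S \<subseteq> commutant S"
    using comm by (auto simp: commutant_def commutative_set_def)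
  ultimately have "x \<in> commutant S" and "y \<in> commutant (commutant S)"
    by (auto simp: commutant_def)
  then show "x * y = y * x"
    by (simp add: commutant_def)
next
  fix x y assume "x \<in> commutant (commutant S)" and inv: "x * y = 1" "y * x = 1"
  show "y \<in> commutant (commutant S)"
    unfolding commutant_def[of "commutant S"]
  proof (intro CollectI ballI)
    fix w assume "w \<in> commutant S"
    then have "x * w = w * x"
      using \<open>x \<in> commutant (commutant S)\<close> by (simp add: commutant_def)
    then have "y * (x * w) * y = y * (w * x) * y"
      by simp
    then have "(y * x) * w * y = y * w * (x * y)"
      by (simp only: mult.assoc)
    then show "y * w = w * y"
      by (simp add: inv)
  qed
next
  fix x y assume "x \<in> commutant (commutant S)" "y \<in> commutant (commutant S)"
  then have xy: "\<And>w. w \<in> commutant S \<Longrightarrow> x * w = w * x" "\<And>w. w \<in> commutant S \<Longrightarrow> y * w = w * y"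
    by (simp_all add: commutant_def)
  then show "x + y \<in> commutant (commutant S)"
    unfolding commutant_def[of "commutant S"] by (simp add: distrib_left distrib_right)
  show "x * y \<in> commutant (commutant S)"
    unfolding commutant_def[of "commutant S"]
  proof (intro CollectI ballI)
    fix w assume "w \<in> commutant S"
    then have "x * (y * w) = x * (w * y)" "(x * w) * y = (w * x) * y"
      using xy by simp_all
    then show "x * y * w = w * (x * y)"
      by (simp only: mult.assoc)
  qed
next
  fix x z assume "x \<in> commutant (commutant S)"
  then show "z *\<^sub>C x \<in> commutant (commutant S)"
    unfolding commutant_def[of "commutant S"] by (simp add: mult_scaleC_left mult_scaleC_right)
qed

lemma subset_bicommutant: "S \<subseteq> commutant (commutant S)"
  by (auto simp: commutant_def)

section \<open>Tracial positive maps with commutative range\<close>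

lemma complex_linear_simps:
  assumes "complex_linear \<Phi>"
  shows "\<Phi> (x + y) = \<Phi> x + \<Phi> y" and "\<Phi> (z *\<^sub>C x) = z *\<^sub>C \<Phi> x" and "\<Phi> (x - y) = \<Phi> x - \<Phi> y"
    and "\<Phi> (- x) = - \<Phi> x"
proof -
  show add: "\<Phi> (x + y) = \<Phi> x + \<Phi> y" for x y
    using assms by (simp add: complex_linear_def)
  show "\<Phi> (z *\<^sub>C x) = z *\<^sub>C \<Phi> x"
    using assms by (simp add: complex_linear_def)
  show "\<Phi> (x - y) = \<Phi> x - \<Phi> y"
    using add[of "x - y" y] by simp
  show "\<Phi> (- x) = - \<Phi> x"
    using add[of 0 0] add[of x "- x"] by (simp add: eq_neg_iff_add_eq_0 add.commute)
qed

text \<open>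
  Polarization: the values of \<open>\<Phi>\<close> at \<open>(u + v)\<^sup>\<star> (u + v)\<close> and \<open>(u + \<i> v)\<^sup>\<star> (u + \<i> v)\<close> are
  self-adjoint.
\<close>
lemma positive_map_star:
  fixes \<Phi> :: "'a::cstar_algebra \<Rightarrow> 'b::unital_cstar_algebra"
  assumes lin: "complex_linear \<Phi>" and pos: "positive_map \<Phi>"
  shows "(\<Phi> (u\<^sup>\<star> * v))\<^sup>\<star> = \<Phi> (v\<^sup>\<star> * u)"
proof -
  note lin_simps = complex_linear_simps[OF lin]
  have sa: "(\<Phi> (w\<^sup>\<star> * w))\<^sup>\<star> = \<Phi> (w\<^sup>\<star> * w)" for w
  proof -
    have "cstar_positive (\<Phi> (w\<^sup>\<star> * w))"
      using pos by (auto simp: positive_map_def cstar_positive_def)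
    then show ?thesis
      using positive_selfadjoint selfadjoint_def by blast
  qed
  have real: "(\<Phi> (u\<^sup>\<star> * w))\<^sup>\<star> + (\<Phi> (w\<^sup>\<star> * u))\<^sup>\<star> = \<Phi> (u\<^sup>\<star> * w) + \<Phi> (w\<^sup>\<star> * u)" for w
    using sa[of "u + w"] sa[of u] sa[of w]
    by (simp add: star_add distrib_left distrib_right lin_simps algebra_simps)
  have "\<i> *\<^sub>C (\<Phi> (v\<^sup>\<star> * u))\<^sup>\<star> - \<i> *\<^sub>C (\<Phi> (u\<^sup>\<star> * v))\<^sup>\<star> = \<i> *\<^sub>C \<Phi> (u\<^sup>\<star> * v) - \<i> *\<^sub>C \<Phi> (v\<^sup>\<star> * u)"
    using real[of "\<i> *\<^sub>C v"]
    by (simp add: star_simps mult_scaleC_left mult_scaleC_right lin_simps)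
  then have "\<i> *\<^sub>C ((\<Phi> (v\<^sup>\<star> * u))\<^sup>\<star> - (\<Phi> (u\<^sup>\<star> * v))\<^sup>\<star>) = \<i> *\<^sub>C (\<Phi> (u\<^sup>\<star> * v) - \<Phi> (v\<^sup>\<star> * u))"
    by (simp only: complex_vs.scale_right_diff_distrib)
  then have imag: "(\<Phi> (v\<^sup>\<star> * u))\<^sup>\<star> - (\<Phi> (u\<^sup>\<star> * v))\<^sup>\<star> = \<Phi> (u\<^sup>\<star> * v) - \<Phi> (v\<^sup>\<star> * u)"
    by (simp only: complex_vs.scale_cancel_left) simp
  have "2 *\<^sub>R (\<Phi> (u\<^sup>\<star> * v))\<^sup>\<star>
      = ((\<Phi> (u\<^sup>\<star> * v))\<^sup>\<star> + (\<Phi> (v\<^sup>\<star> * u))\<^sup>\<star>) - ((\<Phi> (v\<^sup>\<star> * u))\<^sup>\<star> - (\<Phi> (u\<^sup>\<star> * v))\<^sup>\<star>)"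
    by (simp add: scaleR_2)
  also have "\<dots> = 2 *\<^sub>R \<Phi> (v\<^sup>\<star> * u)"
    unfolding real imag by (simp add: scaleR_2)
  finally have "2 *\<^sub>R (\<Phi> (u\<^sup>\<star> * v))\<^sup>\<star> = 2 *\<^sub>R \<Phi> (v\<^sup>\<star> * u)" .
  then show ?thesis by simp
qed

lemma cstar_inv:
  assumes "cstar_invertible x"
  shows "x * cstar_inv x = 1" and "cstar_inv x * x = 1"
proof -
  obtain y where y: "x * y = 1" "y * x = 1"
    using assms by (auto simp: cstar_invertible_def)
  have "z = y" if "x * z = 1" for z
  proof -
    have "y * (x * z) = (y * x) * z"
      by (simp only: mult.assoc)
    then show ?thesis
      by (simp add: that y)
  qed
  then have "cstar_inv x = y"
    unfolding cstar_inv_def by (intro the_equality conjI y) blast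
  then show "x * cstar_inv x = 1" and "cstar_inv x * x = 1"
    using y by (simp_all only:)
qed

text \<open>
  The form \<open>\<Phi> (u\<^sup>\<star> v)\<close> with a distinguished vector \<open>e\<close> such that \<open>\<Phi> (e\<^sup>\<star> e)\<close> has the inverse \<open>s\<close>. The
  covariance is the Schur complement of this form with respect to \<open>e\<close>.
\<close>
locale commutative_positive_form =
  fixes \<Phi> :: "'a::cstar_algebra \<Rightarrow> 'b::unital_cstar_algebra"
    and e :: 'a and s :: 'b
  assumes linear: "complex_linear \<Phi>" and positive: "positive_map \<Phi>"
    and commutative: "commutative_set (range \<Phi>)"
    and s: "\<Phi> (e\<^sup>\<star> * e) * s = 1" "s * \<Phi> (e\<^sup>\<star> * e) = 1"
begin

text \<open>
  A bicommutant, since it has to contain \<open>s\<close> besides the values of the form.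
\<close>
definition W :: "'b set"
  where "W = commutant (commutant {\<Phi> (u\<^sup>\<star> * v) | u v. True})"

sublocale commutative_star_subalgebra W
  unfolding W_def
proof (rule bicommutant_commutative_star_subalgebra)
  show "commutative_set {\<Phi> (u\<^sup>\<star> * v) | u v. True}"
    using commutative by (auto simp: commutative_set_def)
  show "x\<^sup>\<star> \<in> {\<Phi> (u\<^sup>\<star> * v) | u v. True}" if "x \<in> {\<Phi> (u\<^sup>\<star> * v) | u v. True}" for x
    using that positive_map_star[OF linear positive] by blast
qed

definition gram :: "'a \<Rightarrow> 'a \<Rightarrow> 'b"
  where "gram u v = \<Phi> (u\<^sup>\<star> * v)"

definition cov :: "'a \<Rightarrow> 'a \<Rightarrow> 'b"
  where "cov u v = gram u v - gram u e * s * gram e v"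

lemma gram_mem: "gram u v \<in> W"
  unfolding W_def gram_def by (rule subsetD[OF subset_bicommutant]) auto

lemma s_mem: "s \<in> W"
  by (rule inverse_closed[OF gram_mem[of e e, unfolded gram_def] s])

lemma gram_star: "(gram u v)\<^sup>\<star> = gram v u"
  unfolding gram_def by (rule positive_map_star[OF linear positive])

lemma gram_positive: "cstar_positive (gram u u)"
  using positive by (auto simp: gram_def positive_map_def cstar_positive_def)

lemma s_star: "s\<^sup>\<star> = s"
  by (rule star_inverse_selfadjoint[OF _ s(1)]) (simp add: selfadjoint_def gram_star[unfolded gram_def])

lemma gram_expand: "gram (u + z *\<^sub>C v) (u + z *\<^sub>C v)
    = gram u u + z *\<^sub>C gram u v + cnj z *\<^sub>C gram v u + (cmod z)\<^sup>2 *\<^sub>R gram v v"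
  unfolding gram_def scaleR_scaleC complex_norm_square
  by (simp add: star_simps distrib_left distrib_right mult_scaleC_left mult_scaleC_right
      complex_linear_simps[OF linear] scaleC_scaleC scaleC_add_right add_ac)

lemma cov_expand: "cov (u + z *\<^sub>C v) (u + z *\<^sub>C v)
    = cov u u + z *\<^sub>C cov u v + cnj z *\<^sub>C (cov u v)\<^sup>\<star> + (cmod z)\<^sup>2 *\<^sub>R cov v v"
proof -
  have "gram (u + z *\<^sub>C v) e = gram u e + cnj z *\<^sub>C gram v e"
    and "gram e (u + z *\<^sub>C v) = gram e u + z *\<^sub>C gram e v"
    by (simp_all add: gram_def star_simps distrib_left distrib_right mult_scaleC_left
        mult_scaleC_right complex_linear_simps[OF linear])
  then show ?thesis
    unfolding cov_def gram_expand scaleR_scaleC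
    by (simp add: star_simps gram_star s_star distrib_left distrib_right mult_scaleC_left
        mult_scaleC_right scaleC_scaleC scaleC_add_right complex_vs.scale_right_diff_distrib
        mult.assoc complex_norm_square[symmetric] mult.commute[of z] del: of_real_power)
qed

lemma cov_mem: "cov u v \<in> W"
  by (simp add: cov_def gram_mem s_mem closed)

lemma cov_star: "(cov u v)\<^sup>\<star> = cov v u"
  by (simp add: cov_def star_simps gram_star s_star mult.assoc)

text \<open>
  The covariance is the Schur complement of the quadratic polynomial \<open>\<Phi> ((u + z e)\<^sup>\<star> (u + z e))\<close> in \<open>z\<close>.
\<close>
lemma cov_positive: "cstar_positive (cov u u)"
proof -
  have "cstar_positive (gram u u - gram u e * s * (gram u e)\<^sup>\<star>)"
  proof (rule schur_complement_positive[OF gram_mem gram_mem gram_mem[of e e]])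
    show "selfadjoint (gram e e)"
      by (simp add: selfadjoint_def gram_star)
    show "gram e e * s = 1" "s * gram e e = 1"
      by (simp_all add: gram_def s)
    show "cstar_positive (gram u u + z *\<^sub>C gram u e + cnj z *\<^sub>C (gram u e)\<^sup>\<star> + (cmod z)\<^sup>2 *\<^sub>R gram e e)" for z
      using gram_positive[of "u + z *\<^sub>C e"] unfolding gram_expand gram_star .
  qed
  then show ?thesis
    by (simp add: cov_def gram_star)
qed

text \<open>
  Cauchy-Schwarz applies because the covariance is itself a positive sesquilinear form.
\<close>
lemma cov_cauchy_schwarz: "cstar_positive (cov u u * cov v v - cov u v * (cov u v)\<^sup>\<star>)"
proof (rule cauchy_schwarz[OF cov_mem cov_mem cov_mem _ cov_positive])
  show "cstar_positive (cov u u + z *\<^sub>C cov u v + cnj z *\<^sub>C (cov u v)\<^sup>\<star> + (cmod z)\<^sup>2 *\<^sub>R cov v v)" for z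
    using cov_positive[of "u + z *\<^sub>C v"] unfolding cov_expand .
qed

end

theorem theorem2p3:
  fixes \<Phi> :: "'a::cstar_algebra \<Rightarrow> 'b::unital_cstar_algebra"
    and \<rho> :: 'a
  assumes "complex_linear \<Phi>" and "positive_map \<Phi>" and "tracial \<Phi>"
    and "cstar_positive \<rho>" and "strictly_positive (\<Phi> \<rho>)"
    and "commutative_set (range \<Phi>)"
  shows "\<forall>A B. selfadjoint A \<longrightarrow> selfadjoint B \<longrightarrow>
      (1/4) *\<^sub>R (cstar_abs (\<Phi> (\<rho> * commutator A B)))\<^sup>2
        \<le>\<^sub>* V' \<rho> \<Phi> A * V' \<rho> \<Phi> B - (cstar_abs (real_part (Cov' \<rho> \<Phi> A B)))\<^sup>2
    \<and> (1/4) *\<^sub>R (cstar_abs (\<Phi> (\<rho> * commutator A B)))\<^sup>2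
        \<le>\<^sub>* V' \<rho> \<Phi> A * V' \<rho> \<Phi> B"
proof (intro allI impI)
  fix A B :: 'a assume A: "selfadjoint A" and B: "selfadjoint B"
  obtain w where \<rho>: "\<rho> = w\<^sup>\<star> * w"
    using assms(4) by (auto simp: cstar_positive_def)
  define e where "e = w\<^sup>\<star>"
  define s where "s = cstar_inv (\<Phi> \<rho>)"
  have shift: "\<Phi> (\<rho> * x) = \<Phi> (w * x * w\<^sup>\<star>)" for x
  proof -
    have "\<Phi> (w\<^sup>\<star> * (w * x)) = \<Phi> ((w * x) * w\<^sup>\<star>)"
      using assms(3) by (simp only: tracial_def)
    then show ?thesis by (simp add: \<rho> mult.assoc)
  qed
  have \<Phi>\<rho>: "\<Phi> \<rho> = \<Phi> (e\<^sup>\<star> * e)"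
    using assms(3) by (simp add: \<rho> e_def star_star tracial_def)
  have inv: "\<Phi> \<rho> * s = 1" "s * \<Phi> \<rho> = 1"
    unfolding s_def using assms(5) by (simp_all add: strictly_positive_def cstar_inv)
  interpret commutative_positive_form \<Phi> e s
    by standard (use assms inv \<Phi>\<rho> in simp_all)
  have Cov: "Cov' \<rho> \<Phi> X Y = cov (X * e) (Y * e)" for X Y
  proof -
    have "\<Phi> (\<rho> * X\<^sup>\<star> * Y) = gram (X * e) (Y * e)" "\<Phi> (\<rho> * X\<^sup>\<star>) = gram (X * e) e"
      "\<Phi> (\<rho> * Y) = gram e (Y * e)"
      unfolding mult.assoc[of \<rho>] shift gram_def
      by (simp_all add: e_def star_simps mult.assoc)
    then show ?thesis
      unfolding Cov'_def s_def[symmetric] cov_def by (simp only:)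
  qed
  define a where "a = cov (A * e) (A * e)"
  define b where "b = cov (B * e) (B * e)"
  define c where "c = cov (A * e) (B * e)"
  have mem: "a \<in> W" "b \<in> W" "c \<in> W" "c\<^sup>\<star> \<in> W"
    by (simp_all add: a_def b_def c_def cov_mem closed)
  have T: "\<Phi> (\<rho> * commutator A B) = c - c\<^sup>\<star>"
  proof -
    have "gram (X * e) e = gram e (X * e)" if "selfadjoint X" for X
      using that by (simp add: gram_def star_simps selfadjoint_def mult.assoc)
    then have "gram (A * e) e * s * gram e (B * e) = gram e (A * e) * s * gram e (B * e)"
      and "gram (B * e) e * s * gram e (A * e) = gram e (B * e) * s * gram e (A * e)"
      using A B by simp_all
    \<comment> \<open>By commutativity \<open>c\<close> and \<open>c\<^sup>\<star>\<close> contain the same correction \<open>\<Phi>(\<rho> A) \<Phi>(\<rho>)\<^sup>-\<^sup>1 \<Phi>(\<rho> B)\<close>.\<close>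
    moreover have "gram e (A * e) * s * gram e (B * e) = gram e (B * e) * s * gram e (A * e)"
      using commute[OF gram_mem gram_mem, of e "A * e" e "B * e"] left_commute[OF gram_mem s_mem]
      by (simp add: mult.assoc)
    ultimately have "c - c\<^sup>\<star> = gram (A * e) (B * e) - gram (B * e) (A * e)"
      unfolding c_def cov_star unfolding cov_def by simp
    also have "\<dots> = \<Phi> (\<rho> * (A * B)) - \<Phi> (\<rho> * (B * A))"
      using A B unfolding shift gram_def
      by (simp add: e_def star_simps selfadjoint_def mult.assoc)
    also have "\<dots> = \<Phi> (\<rho> * commutator A B)"
      by (simp add: commutator_def right_diff_distrib complex_linear_simps[OF assms(1)])
    finally show ?thesis ..
  qed
  \<comment> \<open>As \<open>c\<close> is normal, \<open>c c\<^sup>\<star>\<close> is the sum of the squares of its real and imaginary parts.\<close>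
  define P where "P = (1/4) *\<^sub>R ((c - c\<^sup>\<star>)\<^sup>\<star> * (c - c\<^sup>\<star>))"
  define Q where "Q = (real_part c)\<^sup>\<star> * real_part c"
  have sum: "Q + P = c * c\<^sup>\<star>"
  proof -
    have "Q = (1/4) *\<^sub>R ((c\<^sup>\<star> + c) * (c + c\<^sup>\<star>))"
      by (simp add: Q_def real_part_def star_simps)
    then have "Q + P = (1/4) *\<^sub>R ((c\<^sup>\<star> + c) * (c + c\<^sup>\<star>) + (c\<^sup>\<star> - c) * (c - c\<^sup>\<star>))"
      by (simp add: P_def star_simps scaleR_add_right)
    also have "(c\<^sup>\<star> + c) * (c + c\<^sup>\<star>) + (c\<^sup>\<star> - c) * (c - c\<^sup>\<star>) = 4 *\<^sub>R (c * c\<^sup>\<star>)"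
      using scaleR_left_distrib[of 2 2 "c * c\<^sup>\<star>"] unfolding scaleR_2
      by (simp add: algebra_simps commute[OF mem(4,3)])
    finally show ?thesis by simp
  qed
  have pos: "cstar_positive (a * b - c * c\<^sup>\<star>)"
    unfolding a_def b_def c_def by (rule cov_cauchy_schwarz)
  have Q: "cstar_positive Q"
    unfolding Q_def cstar_positive_def by blast
  have sa: "selfadjoint P" "selfadjoint Q" "selfadjoint (a * b)"
    using commute[OF mem(1,2)]
    by (auto simp: P_def Q_def a_def b_def selfadjoint_def star_simps cov_star)
  have "P \<le>\<^sub>* a * b - Q"
    unfolding cstar_le_def using pos sa
    by (simp add: selfadjoint_intros sum[symmetric] diff_diff_eq)
  moreover have "P \<le>\<^sub>* a * b"
  proof -
    have "cstar_positive ((a * b - c * c\<^sup>\<star>) + Q)"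
      by (rule positive_add[OF pos Q])
    moreover have "(a * b - c * c\<^sup>\<star>) + Q = a * b - P"
      by (simp add: sum[symmetric])
    ultimately have "cstar_positive (a * b - P)"
      by (simp only:)
    then show ?thesis
      unfolding cstar_le_def using sa by blast
  qed
  ultimately show "(1/4) *\<^sub>R (cstar_abs (\<Phi> (\<rho> * commutator A B)))\<^sup>2
        \<le>\<^sub>* V' \<rho> \<Phi> A * V' \<rho> \<Phi> B - (cstar_abs (real_part (Cov' \<rho> \<Phi> A B)))\<^sup>2
    \<and> (1/4) *\<^sub>R (cstar_abs (\<Phi> (\<rho> * commutator A B)))\<^sup>2
        \<le>\<^sub>* V' \<rho> \<Phi> A * V' \<rho> \<Phi> B"
    unfolding V'_def Cov T cstar_abs_square a_def[symmetric] b_def[symmetric] c_def[symmetric]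
      P_def[symmetric] Q_def[symmetric] ..
qed

end
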